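(* There are homotopy equivalences $\mathrm{VR}(T_{5,5};3)\simeq \bigvee_9 S^4$ and $\mathrm{VR}(T_{7,7};4)\simeq S^3$.
   Context: For a metric space $X$ and $r\ge 0$, $\mathrm{VR}(X;r)$ is the simplicial complex on vertex set $X$ whose simplices are the finite nonempty subsets of diameter at most $r$. $T_{n,n}$ is the set $\{0,\dots,n-1\}^2$ with metric $d((i,j),(i',j'))=\min\{|i-i'|,n-|i-i'|\}+\min\{|j-j'|,n-|j-j'|\}$, i.e. the vertex set of the $n\times n$ torus grid graph with its shortest-path metric. *)

theory Defs
  imports "HOL-Analysis.Analysis"
begin

definition VR_simplices :: "'a set \<Rightarrow> ('a \<Rightarrow> 'a \<Rightarrow> 'b::linorder) \<Rightarrow> 'b \<Rightarrow> 'a set set" where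
  "VR_simplices X d r = {S. S \<subseteq> X \<and> finite S \<and> S \<noteq> {} \<and> (\<forall>x\<in>S. \<forall>y\<in>S. d x y \<le> r)}"

text \<open>Geometric realization of a simplicial complex K on a finite vertex set V:
  points of the standard simplex in R^V (barycentric coordinates) whose support is a simplex
  of K, with the subspace topology of the (finite) product topology on R^V.\<close>
definition geometric_realization :: "'a set \<Rightarrow> 'a set set \<Rightarrow> ('a \<Rightarrow> real) topology" where
  "geometric_realization V K =
     subtopology (powertop_real V)
       {f. (\<forall>v\<in>V. 0 \<le> f v) \<and> (\<Sum>v\<in>V. f v) = 1 \<and> {v\<in>V. f v \<noteq> 0} \<in> K}"

definition cyc_dist :: "nat \<Rightarrow> nat \<Rightarrow> nat \<Rightarrow> nat" where
  "cyc_dist n a b = (let k = (if a \<le> b then b - a else a - b) in min k (n - k))"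

definition torus_grid :: "nat \<Rightarrow> (nat \<times> nat) set" where
  "torus_grid n = {0..<n} \<times> {0..<n}"

definition torus_dist :: "nat \<Rightarrow> nat \<times> nat \<Rightarrow> nat \<times> nat \<Rightarrow> nat" where
  "torus_dist n p q = cyc_dist n (fst p) (fst q) + cyc_dist n (snd p) (snd q)"

text \<open>Wedge of k copies of S^m: the j-th sphere lives in coordinate block j (coordinates (j,0..m))
  as the unit sphere centred at e_0, so all spheres pass through the origin and pairwise meet
  only there.\<close>
definition wedge_spheres :: "nat \<Rightarrow> nat \<Rightarrow> (nat \<times> nat \<Rightarrow> real) topology" where
  "wedge_spheres k m =
     subtopology (powertop_real UNIV)
       {x. \<exists>j<k. (\<forall>a i. (a \<noteq> j \<or> i > m) \<longrightarrow> x (a, i) = 0) \<and>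
                  (\<Sum>i\<le>m. (x (j, i) - (if i = 0 then 1 else 0))\<^sup>2) = 1}"

end

theory Submission
  imports Defs
begin

text \<open>A Vietoris--Rips complex is a flag complex, so discrete Morse matchings on it can be described
  by a binary decision tree: the set of all simplices, including the empty one, is split repeatedly
  according to whether a vertex \<open>v\<close> belongs to the simplex, until the remaining simplices either are
  matched by toggling a vertex \<open>p\<close> compatible with every vertex still available, or form a single
  critical simplex. For both complexes there is a tree whose critical simplices all have the same
  dimension \<open>d\<close>: nine of dimension 4, respectively one of dimension 3. Removing first the matched
  pairs above dimension \<open>d\<close> collapses the complex onto a contractible complex with the critical
  simplices attached along their boundaries; collapsing the contractible part to a point gives a
  wedge of \<open>d\<close>-spheres.\<close>

subsection \<open>Collapses of geometric realizations\<close>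

text \<open>No attaching map has to be understood. Since every critical simplex has dimension
  \<open>d\<close>, the pairs whose larger member has dimension above \<open>d\<close> are closed
  under cofaces, so they can be removed at the outset; the critical simplices are then facets. Below
  them the matching leaves only the vertex paired with the empty simplex. Facets attached to a
  contractible complex give a wedge whatever their boundaries are. The quotient by the contractible
  part is never formed: an explicit map into Euclidean coordinates, constant on that part and
  injective off it, serves as the quotient map because the realization is compact. The homotopy
  extension is written down by formulas. The trees are certificates: only their validity and their
  number of critical leaves enter the argument.\<close>

lemma topspace_realization:
  "topspace (geometric_realization V K) =
     {f \<in> extensional V. (\<forall>v\<in>V. 0 \<le> f v) \<and> (\<Sum>v\<in>V. f v) = 1 \<and> {v\<in>V. f v \<noteq> 0} \<in> K}"
  by (auto simp: geometric_realization_def PiE_def)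

lemma continuous_map_into_realization:
  assumes "\<And>v. v \<in> V \<Longrightarrow> continuous_map X euclideanreal (\<lambda>x. g x v)"
    and "\<And>x. x \<in> topspace X \<Longrightarrow> g x \<in> topspace (geometric_realization V K)"
  shows "continuous_map X (geometric_realization V K) g"
proof -
  have "g \<in> topspace X \<rightarrow> extensional V"
    using assms(2) by (auto simp: topspace_realization)
  then show ?thesis
    using assms by (auto simp: geometric_realization_def continuous_map_in_subtopology
        continuous_map_componentwise)
qed

lemma continuous_map_realization_coordinate:
  "v \<in> V \<Longrightarrow> continuous_map (geometric_realization V K) euclideanreal (\<lambda>f. f v)"
  unfolding geometric_realization_def
  by (intro continuous_map_from_subtopology continuous_map_product_projection)

lemma continuous_map_Min_image:
  assumes "finite A" "A \<noteq> {}" "\<And>v. v \<in> A \<Longrightarrow> continuous_map X euclideanreal (\<lambda>x. g x v)"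
  shows "continuous_map X euclideanreal (\<lambda>x. Min (g x ` A))"
  using assms
proof (induction rule: finite_ne_induct)
  case (insert v A)
  then show ?case by (simp add: continuous_map_real_min)
qed simp

definition face_closed :: "'a set set \<Rightarrow> bool" where
  "face_closed K \<longleftrightarrow> (\<forall>I\<in>K. \<forall>J. J \<subseteq> I \<longrightarrow> J \<in> K)"

lemma face_closedD: "face_closed K \<Longrightarrow> I \<in> K \<Longrightarrow> J \<subseteq> I \<Longrightarrow> J \<in> K"
  by (auto simp: face_closed_def)

text \<open>By freeness a point has \<open>m f \<noteq> 0\<close> only if its support is
  \<open>\<tau>\<close> or \<open>insert p \<tau>\<close>, so the deformation moves nothing but the
  two open simplices to be removed and stays inside \<open>insert p \<tau>\<close>. At time 1 some
  vertex of \<open>\<tau>\<close> has lost all its weight.\<close>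

lemma elementary_collapse:
  assumes V: "finite V" "K \<subseteq> Pow V" and K: "face_closed K"
    and tp: "insert p \<tau> \<in> K" "p \<notin> \<tau>" "\<tau> \<noteq> {}"
    and free: "\<And>I. I \<in> K \<Longrightarrow> \<tau> \<subseteq> I \<Longrightarrow> I = \<tau> \<or> I = insert p \<tau>"
  shows "geometric_realization V K homotopy_equivalent_space
         geometric_realization V (K - {\<tau>, insert p \<tau>})"
proof -
  let ?X = "geometric_realization V K"
  let ?K' = "K - {\<tau>, insert p \<tau>}"
  let ?Y = "geometric_realization V ?K'"
  have pV: "p \<in> V" "\<tau> \<subseteq> V"
    using V tp by auto
  then have fin: "finite \<tau>"
    using V(1) finite_subset by blast
  define m where "m f = Min (f ` \<tau>)" for f :: "'a \<Rightarrow> real"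
  have m_le: "m f \<le> f v" if "v \<in> \<tau>" for f v
    using that fin by (simp add: m_def)
  have m_ex: "\<exists>v\<in>\<tau>. f v = m f" for f
  proof -
    have "m f \<in> f ` \<tau>"
      unfolding m_def using fin tp(3) by (intro Min_in) auto
    then show ?thesis
      by (metis imageE)
  qed
  \<comment> \<open>the deformation moves the smallest weight on \<open>\<tau>\<close> from every vertex of \<open>\<tau>\<close> to \<open>p\<close>\<close>
  define c where "c t f = (\<lambda>v\<in>V. f v - (if v \<in> \<tau> then t * m f else 0)
      + (if v = p then t * (real (card \<tau>) * m f) else 0))" for t f
  have m_nonneg: "0 \<le> m f" if "f \<in> topspace ?X" for f
    using m_ex[of f] that pV by (auto simp: topspace_realization) (metis subsetD)
  have c_sum: "(\<Sum>v\<in>V. c t f v) = (\<Sum>v\<in>V. f v)" for t f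
  proof -
    have "(\<Sum>v\<in>V. (if v \<in> \<tau> then t * m f else 0)) = real (card \<tau>) * (t * m f)"
      using V(1) pV(2) by (simp add: sum.If_cases Int_absorb1)
    then show ?thesis
      using V(1) pV(1) by (simp add: c_def sum.distrib sum_subtractf)
  qed
  have c_id: "c t f = f" if "f \<in> extensional V" "m f = 0" for t f
    using that by (auto simp: c_def extensional_def restrict_def)
  have supp_c: "{v \<in> V. c t f v \<noteq> 0} \<subseteq> insert p \<tau>" and supp_f: "\<tau> \<subseteq> {v \<in> V. f v \<noteq> 0}"
    if f: "f \<in> topspace ?X" "m f \<noteq> 0" for t f
  proof -
    have pos: "m f > 0"
      using m_nonneg f by fastforce
    then show *: "\<tau> \<subseteq> {v \<in> V. f v \<noteq> 0}"
      using m_le[of _ f] pV(2) by fastforce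
    then have "{v \<in> V. f v \<noteq> 0} \<subseteq> insert p \<tau>"
      using free[of "{v \<in> V. f v \<noteq> 0}"] f(1) by (auto simp: topspace_realization)
    then show "{v \<in> V. c t f v \<noteq> 0} \<subseteq> insert p \<tau>"
      by (auto simp: c_def)
  qed
  have c_in: "c t f \<in> topspace ?X" if f: "f \<in> topspace ?X" and t: "0 \<le> t" "t \<le> 1" for t f
  proof (cases "m f = 0")
    case True
    then show ?thesis
      using f c_id[of f t] by (simp add: topspace_realization)
  next
    case False
    have "t * m f \<le> f v" if "v \<in> \<tau>" for v
      using m_le[OF that, of f] m_nonneg[OF f] t mult_left_le_one_le[of "m f" t] by linarith
    then have "c t f v \<ge> 0" if "v \<in> V" for v
      using f that t m_nonneg[OF f] tp(2) by (auto simp: c_def topspace_realization)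
    moreover have "{v \<in> V. c t f v \<noteq> 0} \<in> K"
      using supp_c[OF f False] face_closedD[OF K tp(1)] by blast
    ultimately show ?thesis
      using f c_sum[of t f] by (simp add: topspace_realization) (simp add: c_def)
  qed
  have c1: "c 1 f \<in> topspace ?Y" if f: "f \<in> topspace ?X" for f
  proof -
    obtain v where v: "v \<in> \<tau>" "f v = m f"
      using m_ex by blast
    have "c 1 f v = 0"
      using v pV tp(2) by (auto simp: c_def)
    then have "\<not> \<tau> \<subseteq> {v \<in> V. c 1 f v \<noteq> 0}"
      using v by blast
    then show ?thesis
      using c_in[OF f, of 1] by (auto simp: topspace_realization)
  qed
  have Y: "f \<in> topspace ?X" "c 1 f = f" if f: "f \<in> topspace ?Y" for f
  proof -
    show X: "f \<in> topspace ?X"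
      using f by (auto simp: topspace_realization)
    have "m f = 0"
      using supp_f[OF X] free[of "{v \<in> V. f v \<noteq> 0}"] f by (auto simp: topspace_realization)
    then show "c 1 f = f"
      using c_id f by (simp add: topspace_realization)
  qed
  have cm: "continuous_map (prod_topology (top_of_set {0..1}) ?X) euclideanreal (\<lambda>x. snd x v)"
    if "v \<in> V" for v
    using continuous_map_compose[OF continuous_map_snd continuous_map_realization_coordinate[OF that]]
    by (simp add: o_def)
  have ct: "continuous_map (prod_topology (top_of_set {0..1}) ?X) euclideanreal (\<lambda>x. fst x)"
    using continuous_map_fst continuous_map_in_subtopology by blast
  have cmm: "continuous_map (prod_topology (top_of_set {0..1}) ?X) euclideanreal (\<lambda>x. m (snd x))"
    unfolding m_def using pV fin tp(3) by (intro continuous_map_Min_image cm) auto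
  have cc: "continuous_map (prod_topology (top_of_set {0..1}) ?X) ?X (\<lambda>x. c (fst x) (snd x))"
  proof (rule continuous_map_into_realization)
    fix v assume v: "v \<in> V"
    then show "continuous_map (prod_topology (top_of_set {0..1}) ?X) euclideanreal
        (\<lambda>x. c (fst x) (snd x) v)"
      unfolding c_def
      by (cases "v \<in> \<tau>"; cases "v = p"; simp; intro continuous_intros cm cmm ct; simp)
  qed (use c_in in auto)
  have "homotopic_with (\<lambda>x. True) ?X ?X id (c 1)"
    unfolding homotopic_with[where P="\<lambda>_. True", simplified]
    by (intro exI[of _ "\<lambda>x. c (fst x) (snd x)"] conjI cc)
      (auto simp: topspace_realization c_def extensional_def restrict_def)
  moreover have "continuous_map ?X ?Y (c 1)"
  proof (rule continuous_map_into_realization)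
    fix v assume "v \<in> V"
    then show "continuous_map ?X euclideanreal (\<lambda>x. c 1 x v)"
      using continuous_map_compose[OF _ continuous_map_realization_coordinate, of ?X V K "c 1" v]
        continuous_map_o_Pair[OF cc, of 1]
      by (simp add: o_def)
  qed (rule c1)
  moreover have "continuous_map ?Y ?X id"
    by (rule continuous_map_into_realization)
      (use Y(1) continuous_map_realization_coordinate in auto)
  ultimately show ?thesis
    by (intro deformation_retract_imp_homotopy_equivalent_space[of _ "c 1"])
      (auto simp: retraction_maps_def Y(2) homotopic_with_sym)
qed

subsection \<open>Matching trees\<close>

text \<open>A maximal \<open>\<tau>\<close> among the members of \<open>M\<close> without
  \<open>p\<close> is a free face: a coface lies in \<open>M\<close> by \<open>up\<close>, and
  removing \<open>p\<close> from it gives a member of \<open>M\<close> containing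
  \<open>\<tau>\<close>, hence \<open>\<tau>\<close> itself. Removing this pair preserves all
  hypotheses.\<close>

lemma toggle_collapse:
  assumes V: "finite V" "K \<subseteq> Pow V" and K: "face_closed K" and M: "M \<subseteq> K"
    and up: "\<And>I J. I \<in> M \<Longrightarrow> J \<in> K \<Longrightarrow> I \<subseteq> J \<Longrightarrow> J \<in> M"
    and toggle: "\<And>I. I \<in> M \<Longrightarrow> insert p I \<in> M" "\<And>I. I \<in> M \<Longrightarrow> I - {p} \<in> M"
    and ne: "\<And>I. I \<in> M \<Longrightarrow> I \<noteq> {}"
  shows "geometric_realization V K homotopy_equivalent_space geometric_realization V (K - M)"
proof -
  have "finite M"
    using V M by (meson finite_Pow_iff finite_subset)
  then show ?thesis
    using assms(2-)
  proof (induction M arbitrary: K rule: finite_psubset_induct)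
    case (psubset M K)
    let ?N = "{I \<in> M. p \<notin> I}"
    show ?case
    proof (cases "M = {}")
      case True
      then show ?thesis by (simp add: homotopy_equivalent_space_refl)
    next
      case False
      then have "finite ?N" "?N \<noteq> {}"
        using psubset.hyps psubset.prems(6) by auto
      from finite_has_maximal[OF this]
      obtain \<tau> where \<tau>: "\<tau> \<in> M" "p \<notin> \<tau>" and max: "\<And>J. J \<in> M \<Longrightarrow> p \<notin> J \<Longrightarrow> \<tau> \<subseteq> J \<Longrightarrow> \<tau> = J"
        by auto
      let ?E = "{\<tau>, insert p \<tau>}"
      have free: "I \<in> ?E" if "I \<in> K" "\<tau> \<subseteq> I" for I
      proof -
        have "I \<in> M"
          using psubset.prems(4) \<tau> that by blast
        then have "I - {p} \<in> M"
          using psubset.prems(6) by blast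
        then have "\<tau> = I - {p}"
          using max[of "I - {p}"] \<tau> that by blast
        then show ?thesis by auto
      qed
      have "geometric_realization V K homotopy_equivalent_space geometric_realization V (K - ?E)"
      proof (rule elementary_collapse)
        show "insert p \<tau> \<in> K"
          using psubset.prems(3,5) \<tau> by blast
        show "\<tau> \<noteq> {}"
          using psubset.prems(7) \<tau> by blast
        show "I = \<tau> \<or> I = insert p \<tau>" if "I \<in> K" "\<tau> \<subseteq> I" for I
          using free[OF that] by blast
      qed (fact V(1) psubset.prems \<tau>)+
      also have "geometric_realization V (K - ?E) homotopy_equivalent_space
          geometric_realization V (K - ?E - (M - ?E))"
      proof (rule psubset.IH)
        show "M - ?E \<subset> M"
          using \<tau> by blast
        show "face_closed (K - ?E)"
          unfolding face_closed_def
        proof (intro ballI allI impI)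
          fix I J assume IJ: "I \<in> K - ?E" "J \<subseteq> I"
          then have "J \<in> K"
            using face_closedD[OF psubset.prems(2)] by blast
          moreover have "\<not> \<tau> \<subseteq> J"
            using IJ free[of I] by blast
          ultimately show "J \<in> K - ?E" by blast
        qed
        show "insert p I \<in> M - ?E" if "I \<in> M - ?E" for I
          
        proof -
          have "insert p I \<noteq> \<tau>" using \<tau>(2) by blast
          moreover have "insert p I \<noteq> insert p \<tau>"
            using that \<tau>(2) by (cases "p \<in> I") (auto simp: insert_absorb)
          ultimately show ?thesis
            using that psubset.prems(5)[of I] by blast
        qed
        show "I - {p} \<in> M - ?E" if "I \<in> M - ?E" for I

        proof -
          have "I - {p} \<noteq> \<tau>"
            using that \<tau>(2) by (cases "p \<in> I") auto
          then show ?thesis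
            using that psubset.prems(6)[of I] by blast
        qed
        show "J \<in> M - ?E" if "I \<in> M - ?E" "J \<in> K - ?E" "I \<subseteq> J" for I J
          using that psubset.prems(4)[of I J] by blast
      qed (use psubset.prems(1,3,7) in blast)+
      also have "K - ?E - (M - ?E) = K - M"
        using \<tau> psubset.prems(5) by auto
      finally show ?thesis .
    qed
  qed
qed

section \<open>Flag complexes and decision trees\<close>

definition flag_complex :: "('a \<Rightarrow> 'a \<Rightarrow> bool) \<Rightarrow> 'a set \<Rightarrow> 'a set set" where
  "flag_complex R V = {I. I \<subseteq> V \<and> (\<forall>x\<in>I. \<forall>y\<in>I. R x y)}"

lemma face_closed_flag_complex: "face_closed (flag_complex R V)"
  by (auto simp: face_closed_def flag_complex_def)

datatype 'a mtree = Free 'a | Crit | Split 'a "'a mtree" "'a mtree"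

fun leaf :: "'a mtree \<Rightarrow> 'a set \<Rightarrow> 'a option" where
  "leaf (Free p) I = Some p"
| "leaf Crit I = None"
| "leaf (Split v T U) I = (if v \<in> I then leaf T I else leaf U I)"

fun num_crit :: "'a mtree \<Rightarrow> nat" where
  "num_crit (Free p) = 0"
| "num_crit Crit = 1"
| "num_crit (Split v T U) = num_crit T + num_crit U"

text \<open>In \<open>valid_mtree R n S T\<close>, the vertices in \<open>S\<close> are those still undecided and compatible with all
  vertices chosen so far, and \<open>n\<close> is the number of vertices that a critical simplex has yet to acquire.\<close>

fun valid_mtree :: "('a \<Rightarrow> 'a \<Rightarrow> bool) \<Rightarrow> nat \<Rightarrow> 'a list \<Rightarrow> 'a mtree \<Rightarrow> bool" where
  "valid_mtree R n S (Free p) \<longleftrightarrow> p \<in> set S \<and> list_all (R p) S"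
| "valid_mtree R n S Crit \<longleftrightarrow> n = 0 \<and> S = []"
| "valid_mtree R n S (Split v T U) \<longleftrightarrow> n \<noteq> 0 \<and> v \<in> set S \<and>
     valid_mtree R (n - 1) (filter (\<lambda>x. x \<noteq> v \<and> R v x) S) T \<and> valid_mtree R n (filter (\<lambda>x. x \<noteq> v) S) U"

text \<open>These are the simplices that reach a node of the tree: \<open>A\<close> holds the
  accepted vertices, \<open>S\<close> the undecided ones compatible with \<open>A\<close>; rejected
  vertices are in neither set.\<close>

definition cell :: "('a \<Rightarrow> 'a \<Rightarrow> bool) \<Rightarrow> 'a set \<Rightarrow> 'a set \<Rightarrow> 'a set set" where
  "cell R A S = {I \<in> flag_complex R (A \<union> S). A \<subseteq> I}"

text \<open>The invariant of the descent: for symmetric \<open>R\<close> and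
  \<open>J \<subseteq> S\<close> it makes \<open>A \<union> J\<close> a simplex exactly when
  \<open>J\<close> is one.\<close>

definition separated :: "('a \<Rightarrow> 'a \<Rightarrow> bool) \<Rightarrow> 'a set \<Rightarrow> 'a set \<Rightarrow> bool" where
  "separated R A S \<longleftrightarrow> A \<in> flag_complex R A \<and> A \<inter> S = {} \<and> (\<forall>a\<in>A. \<forall>s\<in>S. R a s)"

context
  fixes R :: "'a \<Rightarrow> 'a \<Rightarrow> bool"
  assumes sym: "symp R" and refl: "reflp R"
begin

lemma separated_link:
  "separated R A (set S) \<Longrightarrow> v \<in> set S \<Longrightarrow>
    separated R (insert v A) (set (filter (\<lambda>x. x \<noteq> v \<and> R v x) S))"
  using sym refl by (auto simp: separated_def flag_complex_def symp_def reflp_def)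

lemma separated_deletion:
  "separated R A (set S) \<Longrightarrow> separated R A (set (filter (\<lambda>x. x \<noteq> v) S))"
  by (auto simp: separated_def)

lemma cell_link:
  "v \<in> set S \<Longrightarrow>
    cell R (insert v A) (set (filter (\<lambda>x. x \<noteq> v \<and> R v x) S)) = {I \<in> cell R A (set S). v \<in> I}"
  by (auto simp: cell_def flag_complex_def)

lemma cell_deletion:
  "separated R A (set S) \<Longrightarrow> v \<in> set S \<Longrightarrow>
    cell R A (set (filter (\<lambda>x. x \<noteq> v) S)) = {I \<in> cell R A (set S). v \<notin> I}"
  by (auto simp: cell_def flag_complex_def separated_def)

text \<open>A split deletes \<open>v\<close> from the undecided vertices in both branches, so the
  vertex \<open>p\<close> toggled at a leaf differs from every vertex tested on the way there, and
  toggling it changes no decision. It stays in the complex because \<open>p\<close> is compatible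
  with \<open>S\<close> by validity and with \<open>A\<close> by separation.\<close>

lemma leaf_toggle:
  assumes "valid_mtree R n S T" "separated R A (set S)" "I \<in> cell R A (set S)" "leaf T I = Some p"
  shows "p \<in> set S \<and> insert p I \<in> cell R A (set S) \<and> I - {p} \<in> cell R A (set S)
    \<and> leaf T (insert p I) = Some p \<and> leaf T (I - {p}) = Some p"
  using assms
proof (induction T arbitrary: n S A)
  case (Free q)
  then have "R p s" if "s \<in> A \<union> set S" for s
    using that sym by (auto simp: separated_def list_all_iff symp_def)
  moreover have "R s p" if "s \<in> A \<union> set S" for s
    using calculation[OF that] sym by (auto simp: symp_def)
  moreover have "R p p"
    using refl by (auto simp: reflp_def)
  ultimately show ?case
    using Free by (auto simp: cell_def flag_complex_def separated_def subset_iff)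
next
  case Crit
  then show ?case by simp
next
  case (Split v T U)
  then have v: "v \<in> set S" by simp
  show ?case
  proof (cases "v \<in> I")
    case True
    have "I \<in> cell R (insert v A) (set (filter (\<lambda>x. x \<noteq> v \<and> R v x) S))"
      unfolding cell_link[OF v] using True Split.prems by simp
    from Split.IH(1)[OF _ separated_link[OF Split.prems(2) v] this]
    have "p \<in> set S" "p \<noteq> v" "insert p I \<in> cell R A (set S)" "I - {p} \<in> cell R A (set S)"
      "leaf T (insert p I) = Some p" "leaf T (I - {p}) = Some p"
      unfolding cell_link[OF v] using Split.prems(1,4) True by auto
    then show ?thesis
      using True by simp
  next
    case False
    have "I \<in> cell R A (set (filter (\<lambda>x. x \<noteq> v) S))"
      unfolding cell_deletion[OF Split.prems(2) v] using False Split.prems by simp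
    from Split.IH(2)[OF _ separated_deletion[OF Split.prems(2)] this]
    have "p \<in> set S" "p \<noteq> v" "insert p I \<in> cell R A (set S)" "I - {p} \<in> cell R A (set S)"
      "leaf U (insert p I) = Some p" "leaf U (I - {p}) = Some p"
      unfolding cell_deletion[OF Split.prems(2) v] using Split.prems(1,4) False by auto
    then show ?thesis
      using False by simp
  qed
qed

text \<open>Accepting a vertex enlarges \<open>A\<close> and lowers \<open>n\<close> by one, so
  \<open>card A + n\<close> is constant along a branch; \<open>n \<noteq> 0\<close> at a split keeps
  the subtraction from truncating. At \<open>Crit\<close> nothing is undecided and \<open>A\<close>
  is the only simplex.\<close>

lemma critical_cells:
  assumes "valid_mtree R n S T" "separated R A (set S)" "finite A"
  shows "card {I \<in> cell R A (set S). leaf T I = None} = num_crit T"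
    and "I \<in> cell R A (set S) \<Longrightarrow> leaf T I = None \<Longrightarrow> card I = card A + n"
  using assms
proof (induction T arbitrary: n S A)
  case (Free q)
  { case 1 then show ?case by simp }
  { case 2 then show ?case by simp }
next
  case Crit
  { case 1
    then have "cell R A (set S) = {A}"
      by (auto simp: cell_def flag_complex_def separated_def)
    then show ?case by simp }
  { case 2 then show ?case by (auto simp: cell_def flag_complex_def) }
next
  case (Split v T U)
  { case 1
    let ?S1 = "filter (\<lambda>x. x \<noteq> v \<and> R v x) S" and ?S2 = "filter (\<lambda>x. x \<noteq> v) S"
    from 1 have v: "v \<in> set S" by simp
    let ?C1 = "{I \<in> cell R (insert v A) (set ?S1). leaf T I = None}"
    let ?C2 = "{I \<in> cell R A (set ?S2). leaf U I = None}"
    note cells = cell_link[OF v, of A] cell_deletion[OF 1(2) v]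
    have "{I \<in> cell R A (set S). leaf (Split v T U) I = None} = ?C1 \<union> ?C2"
      unfolding cells by auto
    moreover have "?C1 \<inter> ?C2 = {}"
      unfolding cells by auto
    moreover have "finite (cell R B (set S'))" if "finite B" for B S'
      by (rule finite_subset[of _ "Pow (B \<union> set S')"]) (use that in \<open>auto simp: cell_def flag_complex_def\<close>)
    ultimately have "card {I \<in> cell R A (set S). leaf (Split v T U) I = None} = card ?C1 + card ?C2"
      using 1 by (simp add: card_Un_disjoint del: set_filter)
    also have "card ?C1 = num_crit T"
      by (rule Split.IH(1)[OF _ separated_link[OF 1(2) v]]) (use 1 in auto)
    also have "card ?C2 = num_crit U"
      by (rule Split.IH(3)[OF _ separated_deletion[OF 1(2)]]) (use 1 in auto)
    finally show ?case by simp }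
  { case 2
    let ?S1 = "filter (\<lambda>x. x \<noteq> v \<and> R v x) S" and ?S2 = "filter (\<lambda>x. x \<noteq> v) S"
    from 2 have v: "v \<in> set S" "v \<notin> A" by (auto simp: separated_def)
    show ?case
    proof (cases "v \<in> I")
      case True
      then have "I \<in> cell R (insert v A) (set ?S1)"
        using 2 v by (simp add: cell_link del: set_filter)
      from Split.IH(2)[OF this _ _ separated_link[OF _ v(1)], of "n - 1"]
      have "card I = card (insert v A) + (n - 1)"
        using 2 v True by auto
      then show ?thesis
        using 2 v by auto
    next
      case False
      then have "I \<in> cell R A (set ?S2)"
        using 2 v by (simp add: cell_deletion del: set_filter)
      from Split.IH(4)[OF this _ _ separated_deletion] show ?thesis
        using 2 v False by auto
    qed }
qed

text \<open>\<open>P\<close> tests the number of vertices of the larger member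
  \<open>insert p I\<close>, so both members of a pair are selected together.\<close>

definition matched :: "(nat \<Rightarrow> bool) \<Rightarrow> 'a mtree \<Rightarrow> 'a set \<Rightarrow> 'a set \<Rightarrow> 'a set set" where
  "matched P T A S = {I \<in> cell R A S. \<exists>p. leaf T I = Some p \<and> P (card (insert p I))}"

text \<open>At a split the simplices containing \<open>v\<close> go first: their cofaces contain
  \<open>v\<close> as well, so they are closed under cofaces on their own. Once they are gone, so
  are the remaining matched ones.\<close>

lemma matched_collapse:
  assumes "valid_mtree R n S T" "separated R A (set S)"
    and V: "finite V" and "K \<subseteq> Pow V" "face_closed K" "matched P T A (set S) \<subseteq> K"
    and "\<And>I J. I \<in> matched P T A (set S) \<Longrightarrow> J \<in> K \<Longrightarrow> I \<subseteq> J \<Longrightarrow> J \<in> matched P T A (set S)"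
    and P: "\<And>m. P m \<Longrightarrow> 2 \<le> m"
  shows "geometric_realization V K homotopy_equivalent_space
         geometric_realization V (K - matched P T A (set S))"
  using assms(1,2,4-7)
proof (induction T arbitrary: n S A K)
  case (Free p)
  show ?case
  proof (rule toggle_collapse[where p = p])
    fix I assume I: "I \<in> matched P (Free p) A (set S)"
    then have "I \<in> cell R A (set S)" and card: "P (card (insert p I))"
      by (auto simp: matched_def)
    with leaf_toggle[OF Free.prems(1,2), of I p]
    show "insert p I \<in> matched P (Free p) A (set S)" "I - {p} \<in> matched P (Free p) A (set S)"
      by (auto simp: matched_def)
    \<comment> \<open>The bound \<open>2 \<le> m\<close> excludes the pair of the empty simplex and
      a vertex, which is no collapse.\<close>
    show "I \<noteq> {}"
      using P[OF card] by auto
  qed (use V Free.prems in auto)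
next
  case Crit
  have "matched P Crit A (set S) = {}"
    by (simp add: matched_def)
  then show ?case
    by (simp add: homotopy_equivalent_space_refl)
next
  case (Split v T U)
  let ?S1 = "filter (\<lambda>x. x \<noteq> v \<and> R v x) S" and ?S2 = "filter (\<lambda>x. x \<noteq> v) S"
  let ?M = "matched P (Split v T U) A (set S)"
  let ?M1 = "matched P T (insert v A) (set ?S1)" and ?M2 = "matched P U A (set ?S2)"
  have v: "v \<in> set S"
    using Split.prems(1) by simp
  have M1: "?M1 = {I \<in> ?M. v \<in> I}"
    unfolding matched_def cell_link[OF v] by auto
  have M2: "?M2 = {I \<in> ?M. v \<notin> I}"
    unfolding matched_def cell_deletion[OF Split.prems(2) v] by auto
  have up1: "J \<in> ?M1" if "I \<in> ?M1" "J \<in> K" "I \<subseteq> J" for I J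
    using that Split.prems(6)[of I J] unfolding M1 by blast
  have "geometric_realization V K homotopy_equivalent_space geometric_realization V (K - ?M1)"
  proof (rule Split.IH(1)[OF _ separated_link[OF Split.prems(2) v]])
    show "?M1 \<subseteq> K"
      using Split.prems(5) unfolding M1 by blast
    show "valid_mtree R (n - 1) ?S1 T"
      using Split.prems(1) by simp
  qed (fact Split.prems up1)+
  also have "geometric_realization V (K - ?M1) homotopy_equivalent_space
      geometric_realization V (K - ?M1 - ?M2)"
  proof (rule Split.IH(2)[OF _ separated_deletion[OF Split.prems(2)]])
    show "face_closed (K - ?M1)"
      using Split.prems(4) up1 unfolding face_closed_def by (meson DiffD1 DiffD2 DiffI)
    show "?M2 \<subseteq> K - ?M1"
      using Split.prems(5) unfolding M1 M2 by blast
    show "J \<in> ?M2" if "I \<in> ?M2" "J \<in> K - ?M1" "I \<subseteq> J" for I J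
      using that Split.prems(6)[of I J] unfolding M1 M2 by blast
    show "valid_mtree R n ?S2 U"
      using Split.prems(1) by simp
    show "K - ?M1 \<subseteq> Pow V"
      using Split.prems(3) by blast
  qed
  also have "K - ?M1 - ?M2 = K - ?M"
    unfolding M1 M2 by blast
  finally show ?case .
qed

end

subsection \<open>Collapsing a contractible subspace\<close>

lemma compact_imp_quotient_map:
  assumes "compact_space X" "Hausdorff_space Y" "continuous_map X Y q" "q ` topspace X = topspace Y"
  shows "quotient_map X Y q"
  using assms
  by (intro continuous_closed_imp_quotient_map continuous_imp_closed_map_gen Hausdorff_imp_kc_space)

text \<open>\<open>Y\<close> plays the role of the quotient of \<open>X\<close> by \<open>A\<close>.
  The end \<open>h (1, _)\<close> of the homotopy is constant on \<open>A\<close>, so it factors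
  through \<open>q\<close> and yields the inverse \<open>g\<close>; as \<open>h\<close> keeps
  \<open>A\<close> in \<open>A\<close>, also \<open>q \<circ> h\<close> descends, to a homotopy on
  \<open>Y\<close>.\<close>

lemma homotopy_equivalent_collapse:
  assumes X: "compact_space X" and Y: "Hausdorff_space Y"
    and q: "continuous_map X Y q" "q ` topspace X = topspace Y"
    and inj: "\<And>x y. x \<in> topspace X \<Longrightarrow> y \<in> topspace X \<Longrightarrow> q x = q y \<Longrightarrow> x = y \<or> x \<in> A \<and> y \<in> A"
    and const: "\<And>x y. x \<in> A \<Longrightarrow> y \<in> A \<Longrightarrow> q x = q y"
    and h: "continuous_map (prod_topology (top_of_set {0..1::real}) X) X h"
      "\<And>x. x \<in> topspace X \<Longrightarrow> h (0, x) = x"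
      "\<And>t x. 0 \<le> t \<Longrightarrow> t \<le> 1 \<Longrightarrow> x \<in> A \<Longrightarrow> h (t, x) \<in> A"
      "\<And>x. x \<in> A \<Longrightarrow> h (1, x) = a"
  shows "X homotopy_equivalent_space Y"
proof -
  let ?I = "top_of_set {0..1::real}"
  have h1: "continuous_map X X (\<lambda>x. h (1, x))"
    using continuous_map_o_Pair[OF h(1), of 1] by (simp add: o_def)
  have r1: "h (1, x) = h (1, y)" if "x \<in> topspace X" "y \<in> topspace X" "q x = q y" for x y
    using inj[OF that] h(4) by metis
  obtain g where g: "continuous_map Y X g" "\<And>x. x \<in> topspace X \<Longrightarrow> g (q x) = h (1, x)"
    by (rule quotient_map_lift_exists[OF compact_imp_quotient_map[OF X Y q] h1], erule (2) r1, rule that)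
  let ?q = "\<lambda>(t, x). (t, q x)"
  \<comment> \<open>Compactness makes the product with the interval a quotient map too, which gives
    the continuity of the descended homotopy.\<close>
  have Q: "quotient_map (prod_topology ?I X) (prod_topology ?I Y) ?q"
  proof (rule compact_imp_quotient_map)
    show "compact_space (prod_topology ?I X)"
      using X by (simp add: compact_space_prod_topology compact_space_subtopology)
    show "Hausdorff_space (prod_topology ?I Y)"
      using Y by (simp add: Hausdorff_space_prod_topology Hausdorff_space_subtopology)
    show "continuous_map (prod_topology ?I X) (prod_topology ?I Y) ?q"
      using q(1) by (simp add: continuous_map_prod_top)
    have "?q ` ({0..1} \<times> topspace X) = {0..1} \<times> q ` topspace X"
      by (auto simp: image_iff)
    then show "?q ` topspace (prod_topology ?I X) = topspace (prod_topology ?I Y)"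
      using q(2) by simp
  qed
  have qh: "continuous_map (prod_topology ?I X) Y (q \<circ> h)"
    using h(1) q(1) by (rule continuous_map_compose)
  have resp: "(q \<circ> h) x = (q \<circ> h) y"
    if xy: "x \<in> topspace (prod_topology ?I X)" "y \<in> topspace (prod_topology ?I X)" and eq: "?q x = ?q y" for x y
  proof -
    obtain t x' t' y' where [simp]: "x = (t, x')" "y = (t', y')"
      by (metis surj_pair)
    have t: "t' = t" "0 \<le> t" "t \<le> 1" and "x' \<in> topspace X" "y' \<in> topspace X" "q x' = q y'"
      using xy eq by auto
    with inj[of x' y'] consider "x' = y'" | "x' \<in> A" "y' \<in> A"
      by blast
    then show ?thesis
    proof cases
      case 2
      then show ?thesis
        using const[OF h(3)[OF t(2,3) 2(1)] h(3)[OF t(2,3) 2(2)]] t(1) by simp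
    qed (simp add: t(1))
  qed
  obtain H where H: "continuous_map (prod_topology ?I Y) Y H"
    "\<And>x. x \<in> topspace (prod_topology ?I X) \<Longrightarrow> H (?q x) = (q \<circ> h) x"
    by (rule quotient_map_lift_exists[OF Q qh], erule (2) resp, rule that)
  have "homotopic_with (\<lambda>x. True) X X id (g \<circ> q)"
    unfolding homotopic_with[where P="\<lambda>_. True", simplified]
    by (intro exI[of _ h] conjI h(1)) (use h(2) g(2) in auto)
  moreover have "homotopic_with (\<lambda>x. True) Y Y id (q \<circ> g)"
    unfolding homotopic_with[where P="\<lambda>_. True", simplified]
  proof (intro exI[of _ H] conjI ballI H(1))
    fix y assume "y \<in> topspace Y"
    then obtain x where x: "x \<in> topspace X" "y = q x"
      using q(2) by blast
    then show "H (0, y) = id y" "H (1, y) = (q \<circ> g) y"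
      using H(2)[of "(0, x)"] H(2)[of "(1, x)"] h(2) g(2) by auto
  qed
  ultimately show ?thesis
    unfolding homotopy_equivalent_space_def
    by (intro exI[of _ q] exI[of _ g]) (simp add: q(1) g(1) homotopic_with_sym)
qed

section \<open>Compactness of realizations\<close>

lemma Hausdorff_space_powertop_real: "Hausdorff_space (powertop_real V)"
  by (simp add: Hausdorff_space_product_topology)

text \<open>The realization is a finite union of closed faces \<open>F I\<close>, each closed in a
  cube. Points of \<open>F I\<close> may have support smaller than \<open>I\<close>; face closure
  keeps them in the realization.\<close>

lemma compact_space_realization:
  assumes V: "finite V" "K \<subseteq> Pow V" and K: "face_closed K"
  shows "compact_space (geometric_realization V K)"
proof -
  let ?P = "powertop_real V"
  define F where "F I = {f \<in> PiE V (\<lambda>_. {0..1}). (\<Sum>v\<in>V. f v) = 1 \<and> (\<forall>v\<in>V - I. f v = (0::real))}"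
    for I :: "'a set"
  have c: "continuous_map ?P euclideanreal (\<lambda>f. f v)" if "v \<in> V" for v
    using that by (rule continuous_map_product_projection)
  have "compactin ?P (PiE V (\<lambda>_. {0..1::real}))"
    by (simp add: compactin_PiE)
  moreover have "closedin ?P {f \<in> topspace ?P. (\<Sum>v\<in>V. f v) \<in> {1}}"
    using V(1) c by (intro closedin_continuous_map_preimage[where Y = euclideanreal] continuous_map_sum) auto
  \<comment> \<open>Summing absolute values turns the conditions \<open>f v = 0\<close> off
    \<open>I\<close> into the vanishing of one continuous function.\<close>
  moreover have "closedin ?P {f \<in> topspace ?P. (\<Sum>v\<in>V - I. \<bar>f v\<bar>) \<in> {0}}" for I
    using V(1) c by (intro closedin_continuous_map_preimage[where Y = euclideanreal] continuous_map_sum continuous_map_real_abs) auto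
  ultimately have "compactin ?P (PiE V (\<lambda>_. {0..1}) \<inter> ({f \<in> topspace ?P. (\<Sum>v\<in>V. f v) \<in> {1}}
      \<inter> {f \<in> topspace ?P. (\<Sum>v\<in>V - I. \<bar>f v\<bar>) \<in> {0}}))" for I
    by (intro compact_Int_closedin closedin_Int)
  moreover have "PiE V (\<lambda>_. {0..1}) \<inter> ({f \<in> topspace ?P. (\<Sum>v\<in>V. f v) \<in> {1}}
      \<inter> {f \<in> topspace ?P. (\<Sum>v\<in>V - I. \<bar>f v\<bar>) \<in> {0}}) = F I" for I
    using V(1) by (auto simp: F_def sum_nonneg_eq_0_iff)
  ultimately have "compactin ?P (F I)" for I
    by simp
  moreover have "finite K"
    using V by (meson finite_Pow_iff finite_subset)
  ultimately have "compactin ?P (\<Union>(F ` K))"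
    by (intro compactin_Union) auto
  also have "\<Union>(F ` K) = topspace (geometric_realization V K)" (is "?L = ?T")
  proof (rule sym, intro equalityI subsetI)
    fix f assume f: "f \<in> ?T"
    then have "f v \<le> 1" if "v \<in> V" for v
      using member_le_sum[OF that, of f] V(1) by (auto simp: topspace_realization)
    then have "f \<in> F {v \<in> V. f v \<noteq> 0}"
      using f by (auto simp: F_def topspace_realization PiE_iff)
    then show "f \<in> \<Union>(F ` K)"
      using f by (auto simp: topspace_realization)
  next
    fix f assume "f \<in> \<Union>(F ` K)"
    then obtain I where I: "I \<in> K" "f \<in> F I" by blast
    then have "{v \<in> V. f v \<noteq> 0} \<in> K"
      by (intro face_closedD[OF K I(1)]) (auto simp: F_def)
    then show "f \<in> topspace (geometric_realization V K)"
      using I by (auto simp: F_def topspace_realization PiE_iff)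
  qed
  finally have "compact_space (subtopology ?P ?T)"
    by (simp only: compactin_subspace)
  moreover have "geometric_realization V K = subtopology ?P (topspace (geometric_realization V K))"
    unfolding geometric_realization_def by (metis subtopology_restrict topspace_subtopology)
  ultimately show ?thesis
    by argo
qed

text \<open>In this form inversion is easily checked: if \<open>y_0 = 1\<close>, then
  \<open>x = 2 y / |y|^2\<close> satisfies \<open>|x|^2 = 4 / |y|^2 = 2 x_0\<close>.\<close>

lemma wedge_sphere_iff:
  fixes x :: "nat \<Rightarrow> real"
  shows "(\<Sum>i\<le>m. (x i - (if i = 0 then 1 else 0))\<^sup>2) = 1 \<longleftrightarrow> (\<Sum>i\<le>m. (x i)\<^sup>2) = 2 * x 0"
proof -
  have "(\<Sum>i\<le>m. (x i - (if i = 0 then 1 else 0))\<^sup>2) =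
      (\<Sum>i\<le>m. (x i)\<^sup>2 - (if i = 0 then 2 * x 0 - 1 else 0))"
    by (intro sum.cong) (auto simp: power2_diff)
  also have "\<dots> = (\<Sum>i\<le>m. (x i)\<^sup>2) - (2 * x 0 - 1)"
    by (simp add: sum_subtractf)
  finally show ?thesis by auto
qed

subsection \<open>Facets attached to a contractible complex\<close>

text \<open>Maximality of each \<open>\<sigma> j\<close> lets the facets be removed leaving a
  complex. \<open>enum\<close> fixes their common dimension and the vertex \<open>e j 0\<close> from
  which coordinates on the facet are measured.\<close>

locale facets =
  fixes V :: "'a set" and K :: "'a set set" and \<sigma> :: "nat \<Rightarrow> 'a set" and e :: "nat \<Rightarrow> nat \<Rightarrow> 'a"
    and k d :: nat
  assumes finite_V: "finite V" and K_V: "K \<subseteq> Pow V" and K_closed: "face_closed K"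
    and facet_in: "\<And>j. j < k \<Longrightarrow> \<sigma> j \<in> K"
    and facet: "\<And>j I. j < k \<Longrightarrow> I \<in> K \<Longrightarrow> \<sigma> j \<subseteq> I \<Longrightarrow> I = \<sigma> j"
    and inj_facet: "inj_on \<sigma> {..<k}"
    and enum: "\<And>j. j < k \<Longrightarrow> bij_betw (e j) {..d} (\<sigma> j)"
begin

abbreviation "X \<equiv> geometric_realization V K"
abbreviation "D \<equiv> K - \<sigma> ` {..<k}"
abbreviation "Y \<equiv> geometric_realization V D"

text \<open>On the realization this is positive exactly on the open simplex of
  \<open>\<sigma> j\<close>. When a point there is split into barycentre and boundary point, the
  barycentre has weight \<open>real (Suc d) * low j f\<close>.\<close>

definition low :: "nat \<Rightarrow> ('a \<Rightarrow> real) \<Rightarrow> real" where "low j f = Min (f ` \<sigma> j)"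

lemma facet_basic:
  assumes "j < k"
  shows "finite (\<sigma> j)" "\<sigma> j \<noteq> {}" "\<sigma> j \<subseteq> V" "card (\<sigma> j) = Suc d" "\<sigma> j = e j ` {..d}"
proof -
  note b = enum[OF assms]
  show im: "\<sigma> j = e j ` {..d}" using b by (simp add: bij_betw_def)
  show "finite (\<sigma> j)" "\<sigma> j \<noteq> {}" unfolding im by auto
  show "\<sigma> j \<subseteq> V" using facet_in[OF assms] K_V by auto
  show "card (\<sigma> j) = Suc d" using bij_betw_same_card[OF b] by simp
qed

lemma low_le: "j < k \<Longrightarrow> v \<in> \<sigma> j \<Longrightarrow> low j f \<le> f v"
  using facet_basic(1) by (simp add: low_def)

lemma low_attained: assumes "j < k" obtains v where "v \<in> \<sigma> j" "f v = low j f"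
proof -
  have "low j f \<in> f ` \<sigma> j"
    unfolding low_def using facet_basic(1,2)[OF assms] by (intro Min_in) auto
  then show ?thesis using that by (metis imageE)
qed

lemma low_nonneg:
  assumes "f \<in> topspace X" "j < k" shows "0 \<le> low j f"
proof -
  obtain v where v: "v \<in> \<sigma> j" "f v = low j f" using low_attained[OF assms(2)] .
  then have "v \<in> V" using facet_basic(3)[OF assms(2)] by blast
  then have "0 \<le> f v" using assms(1) by (simp add: topspace_realization)
  then show ?thesis using v(2) by simp
qed

text \<open>A nonzero minimum makes the support contain \<open>\<sigma> j\<close>, and maximality
  makes it equal. So at each point at most one facet is active.\<close>

lemma low_nonzero:
  assumes f: "f \<in> topspace X" and j: "j < k" "low j f \<noteq> 0"
  shows "{v \<in> V. f v \<noteq> 0} = \<sigma> j" "\<And>i. i < k \<Longrightarrow> i \<noteq> j \<Longrightarrow> low i f = 0" "(\<Sum>v\<in>\<sigma> j. f v) = 1"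
proof -
  have supp: "{v \<in> V. f v \<noteq> 0} = \<sigma> i" if i: "i < k" "low i f \<noteq> 0" for i
  proof (rule facet[OF i(1)])
    show "{v \<in> V. f v \<noteq> 0} \<in> K" using f by (simp add: topspace_realization)
    have "f v \<noteq> 0" if "v \<in> \<sigma> i" for v
      using low_le[OF i(1) that, of f] low_nonneg[OF f i(1)] i(2) by linarith
    then show "\<sigma> i \<subseteq> {v \<in> V. f v \<noteq> 0}" using facet_basic(3)[OF i(1)] by auto
  qed
  show s: "{v \<in> V. f v \<noteq> 0} = \<sigma> j" using supp j by blast
  show "low i f = 0" if "i < k" "i \<noteq> j" for i
    using supp[OF that(1)] s inj_facet that j(1) by (auto dest: inj_onD)
  have "(\<Sum>v\<in>V. f v) = (\<Sum>v\<in>\<sigma> j. f v)"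
    using finite_V s by (intro sum.mono_neutral_right) auto
  then show "(\<Sum>v\<in>\<sigma> j. f v) = 1" using f by (simp add: topspace_realization)
qed

lemma in_Y_iff: "f \<in> topspace Y \<longleftrightarrow> f \<in> topspace X \<and> (\<forall>j<k. low j f = 0)"
proof -
  have "\<forall>j<k. low j f = 0" if f: "f \<in> topspace Y"
  proof (intro allI impI, rule ccontr)
    fix j assume j: "j < k" "low j f \<noteq> 0"
    have "f \<in> topspace X" using f by (auto simp: topspace_realization)
    from low_nonzero(1)[OF this j] show False using f j(1) by (auto simp: topspace_realization)
  qed
  moreover have "f \<in> topspace Y" if f: "f \<in> topspace X" "\<forall>j<k. low j f = 0"
  proof -
    have "{v \<in> V. f v \<noteq> 0} \<noteq> \<sigma> j" if "j < k" for j
      using low_attained[OF that, of f] f(2) that by (metis (mono_tags, lifting) mem_Collect_eq)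
    then show ?thesis using f(1) by (auto simp: topspace_realization)
  qed
  ultimately show ?thesis by (auto simp: topspace_realization)
qed

lemma continuous_map_low: "j < k \<Longrightarrow> continuous_map X euclideanreal (low j)"
  unfolding low_def[abs_def] using facet_basic[of j]
  by (intro continuous_map_Min_image continuous_map_realization_coordinate) auto

text \<open>The map \<open>chart\<close> uses that inversion maps the affine hyperplane \<open>x\<^sub>0 = 1\<close> onto the unit sphere
  centred at \<open>e\<^sub>0\<close> without the origin. On the open simplex spanned by \<open>\<sigma> j\<close> the point of the
  hyperplane is \<open>(1, (f\<^sub>i - f\<^sub>0) / min f)\<close>, which tends to infinity at the boundary. The last summand
  of \<open>norm2\<close> vanishes on that simplex and only keeps the denominator positive elsewhere.\<close>

definition dir :: "nat \<Rightarrow> ('a \<Rightarrow> real) \<Rightarrow> nat \<Rightarrow> real" where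
  "dir j f i = (if i = 0 then low j f else f (e j i) - f (e j 0))"

definition norm2 :: "nat \<Rightarrow> ('a \<Rightarrow> real) \<Rightarrow> real" where
  "norm2 j f = (\<Sum>i\<le>d. (dir j f i)\<^sup>2) + (1 - (\<Sum>v\<in>\<sigma> j. f v))\<^sup>2"

definition chart :: "('a \<Rightarrow> real) \<Rightarrow> nat \<times> nat \<Rightarrow> real" where
  "chart f = (\<lambda>(j, i). if j < k \<and> i \<le> d then 2 * low j f * dir j f i / norm2 j f else 0)"

lemma enum_in: "j < k \<Longrightarrow> i \<le> d \<Longrightarrow> e j i \<in> \<sigma> j"
  using facet_basic(5)[of j] by auto

text \<open>If every \<open>dir j f i\<close> vanishes, \<open>f\<close> is constant on
  \<open>\<sigma> j\<close> with minimum 0, and then the last summand is 1. This holds for every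
  \<open>f\<close>, so the division in \<open>chart\<close> is continuous on all of
  \<open>X\<close>.\<close>

lemma norm2_pos:
  assumes "j < k" shows "0 < norm2 j f"
proof (rule ccontr)
  assume "\<not> 0 < norm2 j f"
  moreover have "0 \<le> (\<Sum>i\<le>d. (dir j f i)\<^sup>2)" by (simp add: sum_nonneg)
  moreover have "0 \<le> (1 - (\<Sum>v\<in>\<sigma> j. f v))\<^sup>2" by simp
  ultimately have "(\<Sum>i\<le>d. (dir j f i)\<^sup>2) = 0" and s: "(1 - (\<Sum>v\<in>\<sigma> j. f v))\<^sup>2 = 0"
    unfolding norm2_def by linarith+
  then have dir0: "dir j f i = 0" if "i \<le> d" for i
    using that by (simp add: sum_nonneg_eq_0_iff)
  have same: "f v = f (e j 0)" if "v \<in> \<sigma> j" for v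
  proof -
    obtain i where "i \<le> d" "v = e j i" using \<open>v \<in> \<sigma> j\<close> facet_basic(5)[OF assms] by auto
    then show ?thesis using dir0[of i] by (auto simp: dir_def split: if_splits)
  qed
  obtain w where w: "w \<in> \<sigma> j" "f w = low j f" using low_attained[OF assms] .
  have "low j f = 0" using dir0[of 0] by (simp add: dir_def)
  then have "f v = 0" if "v \<in> \<sigma> j" for v using same[OF that] same[OF w(1)] w(2) by simp
  then show False using s by simp
qed

text \<open>On the open facet the block is the inversion \<open>2 y / |y|^2\<close> of
  \<open>y = dir j f / low j f\<close>. Clearing \<open>low j f\<close> from the denominators gives
  the formula of \<open>chart\<close>, which also makes sense, and vanishes, off the open
  facet.\<close>

lemma chart_square_sum:
  assumes f: "f \<in> topspace X" and j: "j < k"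
  shows "(\<Sum>i\<le>d. (chart f (j, i))\<^sup>2) = 2 * chart f (j, 0)"
proof (cases "low j f = 0")
  case False
  have N: "(\<Sum>i\<le>d. (dir j f i)\<^sup>2) = norm2 j f"
    using low_nonzero(3)[OF f j False] by (simp add: norm2_def)
  have "(\<Sum>i\<le>d. (chart f (j, i))\<^sup>2) = (\<Sum>i\<le>d. (2 * low j f / norm2 j f)\<^sup>2 * (dir j f i)\<^sup>2)"
    using j by (intro sum.cong) (auto simp: chart_def power_divide power_mult_distrib)
  also have "\<dots> = (2 * low j f / norm2 j f)\<^sup>2 * norm2 j f"
    by (simp add: N flip: sum_distrib_left)
  also have "\<dots> = 2 * chart f (j, 0)"
    using norm2_pos[OF j, of f] j by (simp add: chart_def dir_def power2_eq_square)
  finally show ?thesis .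
qed (use j in \<open>simp add: chart_def\<close>)

lemma topspace_wedge:
  "topspace (wedge_spheres k d) =
    {x. \<exists>j<k. (\<forall>a i. (a \<noteq> j \<or> i > d) \<longrightarrow> x (a, i) = 0) \<and> (\<Sum>i\<le>d. (x (j, i))\<^sup>2) = 2 * x (j, 0)}"
  by (simp add: wedge_spheres_def wedge_sphere_iff)

lemma chart_in_wedge:
  assumes f: "f \<in> topspace X" and k: "0 < k"
  shows "chart f \<in> topspace (wedge_spheres k d)"
proof (cases "\<exists>j<k. low j f \<noteq> 0")
  case True
  then obtain j where j: "j < k" "low j f \<noteq> 0" by blast
  then have "\<forall>a i. a \<noteq> j \<or> i > d \<longrightarrow> chart f (a, i) = 0"
    using low_nonzero(2)[OF f j] by (auto simp: chart_def)
  then show ?thesis using chart_square_sum[OF f j(1)] j(1) unfolding topspace_wedge by blast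
next
  case False
  then have "chart f x = 0" for x by (auto simp: chart_def split: prod.splits)
  then show ?thesis using k unfolding topspace_wedge by auto
qed

lemma continuous_map_chart:
  assumes k: "0 < k" shows "continuous_map X (wedge_spheres k d) chart"
proof -
  have c: "continuous_map X euclideanreal (\<lambda>f. f v)" if "v \<in> \<sigma> j" "j < k" for v j
    using that facet_basic(3) by (intro continuous_map_realization_coordinate) auto
  have dir: "continuous_map X euclideanreal (\<lambda>f. dir j f i)" if "j < k" "i \<le> d" for i j
    using that continuous_map_low[of j] enum_in[of j]
    by (cases "i = 0") (auto simp: dir_def intro!: continuous_map_diff c)
  have norm: "continuous_map X euclideanreal (norm2 j)" if "j < k" for j
    unfolding norm2_def[abs_def] using that facet_basic(1)[OF that]
    by (intro continuous_map_add continuous_map_sum continuous_map_real_pow continuous_map_diff dir c) auto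
  have "continuous_map X euclideanreal (\<lambda>f. chart f x)" for x
  proof (cases x)
    case (Pair j i)
    show ?thesis
    proof (cases "j < k \<and> i \<le> d")
      case True
      then have "norm2 j f \<noteq> 0" for f using norm2_pos[of j f] by simp
      with True show ?thesis unfolding Pair chart_def
        by (simp, intro continuous_map_real_divide continuous_map_real_mult norm dir continuous_map_low) auto
    next
      case False
      then have "chart f x = 0" for f unfolding Pair chart_def by auto
      then show ?thesis by simp
    qed
  qed
  then have "continuous_map X (powertop_real UNIV) chart"
    by (simp add: continuous_map_componentwise_UNIV)
  moreover have "chart \<in> topspace X \<rightarrow> topspace (wedge_spheres k d)"
    using chart_in_wedge[OF _ k] by blast
  ultimately show ?thesis
    unfolding wedge_spheres_def by (simp add: continuous_map_in_subtopology)
qed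

lemma chart_const: "f \<in> topspace Y \<Longrightarrow> chart f = (\<lambda>_. 0)"
  by (auto simp: in_Y_iff chart_def fun_eq_iff)

text \<open>Dividing by coordinate 0 undoes the inversion and recovers
  \<open>dir j f i / low j f\<close>. This determines \<open>f\<close> on \<open>\<sigma> j\<close>
  up to an affine change \<open>l * _ + C\<close>; comparing minima forces \<open>C = 0\<close>, and
  total weight 1 forces \<open>l = 1\<close>.\<close>

lemma chart_inj:
  assumes f: "f \<in> topspace X" and g: "g \<in> topspace X" and eq: "chart f = chart g" and nY: "f \<notin> topspace Y"
  shows "f = g"
proof -
  obtain j where j: "j < k" "low j f \<noteq> 0" using nY f in_Y_iff by blast
  have base: "chart h (j, 0) = 2 * (low j h)\<^sup>2 / norm2 j h" for h
    using j(1) by (simp add: chart_def dir_def power2_eq_square)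
  have "chart f (j, 0) \<noteq> 0" unfolding base using j norm2_pos[OF j(1), of f] by simp
  then have g0: "low j g \<noteq> 0" using eq base by auto
  have ratio: "dir j f i / low j f = dir j g i / low j g" if "i \<le> d" for i
  proof -
    have r: "dir j h i / low j h = chart h (j, i) / chart h (j, 0)" if "low j h \<noteq> 0" for h
      unfolding base using that j(1) \<open>i \<le> d\<close> norm2_pos[OF j(1), of h]
      by (simp add: chart_def power2_eq_square)
    show ?thesis unfolding r[OF j(2)] r[OF g0] eq ..
  qed
  define l where "l = low j f / low j g"
  have l: "low j f = l * low j g" "0 < l"
    using g0 j low_nonneg[OF f j(1)] low_nonneg[OF g j(1)] by (auto simp: l_def divide_pos_pos order_less_le)
  define C where "C = f (e j 0) - l * g (e j 0)"
  have aff: "f v = l * g v + C" if "v \<in> \<sigma> j" for v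
  proof -
    obtain i where i: "i \<le> d" "v = e j i" using \<open>v \<in> \<sigma> j\<close> facet_basic(5)[OF j(1)] by auto
    show ?thesis
    proof (cases "i = 0")
      case True then show ?thesis using i by (simp add: C_def)
    next
      case False
      have "dir j f i = l * dir j g i" using ratio[OF i(1)] j(2) g0 by (simp add: l_def field_simps)
      then show ?thesis using False i by (simp add: dir_def C_def algebra_simps)
    qed
  qed
  obtain a where a: "a \<in> \<sigma> j" "f a = low j f" using low_attained[OF j(1)] .
  obtain b where b: "b \<in> \<sigma> j" "g b = low j g" using low_attained[OF j(1)] .
  \<comment> \<open>At a minimiser \<open>a\<close> of \<open>f\<close>,
    \<open>low j f = l * g a + C \<ge> low j f + C\<close>; the minimiser \<open>b\<close> of
    \<open>g\<close> gives the opposite inequality.\<close>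
  have "l * low j g \<le> l * g a" using l(2) low_le[OF j(1) a(1), of g] by simp
  then have "C \<le> 0" using aff[OF a(1)] a(2) l(1) by linarith
  moreover have "0 \<le> C" using aff[OF b(1)] b(2) l low_le[OF j(1) b(1), of f] by simp
  ultimately have fg: "f v = l * g v" if "v \<in> \<sigma> j" for v using aff[OF that] by simp
  have "(\<Sum>v\<in>\<sigma> j. f v) = l * (\<Sum>v\<in>\<sigma> j. g v)" using fg by (simp add: sum_distrib_left)
  then have "l = 1" using low_nonzero(3)[OF f j] low_nonzero(3)[OF g j(1) g0] by simp
  have "f v = g v" if v: "v \<in> V" for v
  proof (cases "v \<in> \<sigma> j")
    case True
    then show ?thesis using fg \<open>l = 1\<close> by simp
  next
    case False
    then have "f v = 0" "g v = 0"
      using v low_nonzero(1)[OF f j] low_nonzero(1)[OF g j(1) g0] by blast+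
    then show ?thesis by simp
  qed
  then show ?thesis using f g by (intro extensionalityI[of _ V]) (auto simp: topspace_realization)
qed

lemma chart_surj:
  assumes ne: "topspace Y \<noteq> {}" and x: "x \<in> topspace (wedge_spheres k d)"
  shows "x \<in> chart ` topspace X"
proof -
  obtain j where j: "j < k" and x0: "\<And>a i. a \<noteq> j \<or> i > d \<Longrightarrow> x (a, i) = 0"
    and sq: "(\<Sum>i\<le>d. (x (j, i))\<^sup>2) = 2 * x (j, 0)"
    using x unfolding topspace_wedge by blast
  show ?thesis
  proof (cases "x (j, 0) = 0")
    case True
    then have "x (j, i) = 0" if "i \<le> d" for i
      using sq that by (simp add: sum_nonneg_eq_0_iff)
    then have "x p = 0" for p
      using x0 by (cases p) (metis not_le)
    moreover obtain f where f: "f \<in> topspace Y" using ne by blast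
    ultimately have "x = chart f" using chart_const[OF f] by auto
    then show ?thesis using f in_Y_iff by blast
  next
    case False
    then have pos: "0 < x (j, 0)"
      using sq sum_nonneg[of "{..d}" "\<lambda>i. (x (j, i))\<^sup>2"] by simp
    \<comment> \<open>Inverting back gives the hyperplane point \<open>(1, z 1, ..., z d)\<close>;
      \<open>z 0\<close> is 0 because it stands for the difference of \<open>f (e j 0)\<close> with
      itself. The weights must differ from the one at \<open>e j 0\<close> by \<open>z i\<close>
      times their minimum, so up to scale they are \<open>z i\<close> shifted to have minimum 1,
      which is \<open>h\<close>.\<close>
    define z where "z i = (if i = 0 then 0 else x (j, i) / x (j, 0))" for i
    define \<mu> where "\<mu> = Min (z ` {..d})"
    define h where "h i = 1 + z i - \<mu>" for i
    define s where "s = (\<Sum>i\<le>d. h i)"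
    have z_ge: "\<mu> \<le> z i" if "i \<le> d" for i using that by (simp add: \<mu>_def)
    have h1: "1 \<le> h i" if "i \<le> d" for i using z_ge[OF that] by (simp add: h_def)
    have "\<mu> \<in> z ` {..d}" unfolding \<mu>_def by (intro Min_in) auto
    then obtain i0 where i0: "i0 \<le> d" "h i0 = 1" by (auto simp: h_def)
    have s: "0 < s" unfolding s_def using h1 by (intro sum_pos) (auto simp: less_le_trans[OF zero_less_one])
    have inje: "inj_on (e j) {..d}" and im: "e j ` {..d} = \<sigma> j"
      using enum[OF j] by (auto simp: bij_betw_def)
    define f where "f = (\<lambda>v\<in>V. if v \<in> \<sigma> j then h (inv_into {..d} (e j) v) / s else 0)"
    have fe: "f (e j i) = h i / s" if "i \<le> d" for i
      using that enum_in[OF j that] facet_basic(3)[OF j] inje by (auto simp: f_def)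
    have fX: "f \<in> topspace X"
    proof -
      have "(\<Sum>v\<in>V. f v) = (\<Sum>v\<in>\<sigma> j. f v)"
        using finite_V facet_basic(3)[OF j] by (intro sum.mono_neutral_right) (auto simp: f_def)
      also have "\<dots> = (\<Sum>i\<le>d. f (e j i))"
        unfolding im[symmetric] using inje by (simp add: sum.reindex)
      also have "\<dots> = 1" using fe s by (simp add: s_def flip: sum_divide_distrib)
      finally have sum: "(\<Sum>v\<in>V. f v) = 1" .
      have nonneg: "0 \<le> f v" if v: "v \<in> V" for v
      proof (cases "v \<in> \<sigma> j")
        case True
        then obtain i where i: "i \<le> d" "v = e j i" using im by auto
        show ?thesis unfolding i(2) fe[OF i(1)] using h1[OF i(1)] s by simp
      qed (use v in \<open>simp add: f_def\<close>)
      have "{v \<in> V. f v \<noteq> 0} \<subseteq> \<sigma> j" by (auto simp: f_def)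
      then have "{v \<in> V. f v \<noteq> 0} \<in> K" using face_closedD[OF K_closed facet_in[OF j]] by blast
      then show ?thesis using sum nonneg by (simp add: topspace_realization) (simp add: f_def)
    qed
    have low: "low j f = 1 / s"
      unfolding low_def
    proof (rule Min_eqI)
      show "1 / s \<le> y" if y: "y \<in> f ` \<sigma> j" for y
      proof -
        obtain i where i: "i \<le> d" "y = f (e j i)" using y unfolding im[symmetric] by auto
        show ?thesis unfolding i(2) fe[OF i(1)] using h1[OF i(1)] s by (simp add: divide_right_mono)
      qed
      show "1 / s \<in> f ` \<sigma> j" using fe[OF i0(1)] i0(2) enum_in[OF j i0(1)] by (metis imageI)
    qed (use facet_basic(1)[OF j] in simp)
    have dir: "dir j f i = (if i = 0 then 1 else z i) / s" if "i \<le> d" for i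
      using that fe[OF that] fe[of 0] by (auto simp: dir_def low h_def z_def diff_divide_distrib[symmetric])
    have dir': "dir j f i = x (j, i) / x (j, 0) / s" if "i \<le> d" for i
      using dir[OF that] False by (auto simp: z_def)
    have lownz: "low j f \<noteq> 0" using low s by simp
    have "norm2 j f = (\<Sum>i\<le>d. (dir j f i)\<^sup>2)"
      using low_nonzero(3)[OF fX j lownz] by (simp add: norm2_def)
    also have "\<dots> = (\<Sum>i\<le>d. (x (j, i))\<^sup>2) / (x (j, 0) * s)\<^sup>2"
      using dir' by (simp add: power_divide power_mult_distrib sum_divide_distrib)
    also have "\<dots> = 2 / (x (j, 0) * s\<^sup>2)"
      unfolding sq using False s by (simp add: power2_eq_square)
    finally have N: "norm2 j f = 2 / (x (j, 0) * s\<^sup>2)" .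
    have "chart f (a, i) = x (a, i)" for a i
    proof (cases "a = j \<and> i \<le> d")
      case True
      then show ?thesis
        using j dir'[of i] False s by (simp add: chart_def low N power2_eq_square)
    next
      case F: False
      then have "x (a, i) = 0" using x0[of a i] by auto
      moreover have "chart f (a, i) = 0"
        using F low_nonzero(2)[OF fX j lownz, of a] by (auto simp: chart_def)
      ultimately show ?thesis by simp
    qed
    then have "x = chart f" by auto
    then show ?thesis using fX by blast
  qed
qed

text \<open>The contraction of \<open>Y\<close> is extended over the facets as in the homotopy extension property of a
  disc and its boundary: up to time \<open>2 * height f\<close> the point \<open>f\<close> is pushed radially away from the
  barycentre, by then it has reached \<open>Y\<close>, and from there on it follows the contraction. Capping
  \<open>cut\<close> at half the weight of the barycentre keeps the denominator in \<open>stretch\<close> at least \<open>1/2\<close>.\<close>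

definition cut :: "nat \<Rightarrow> real \<Rightarrow> ('a \<Rightarrow> real) \<Rightarrow> real" where
  "cut j t f = min (low j f) (t / (2 * real (Suc d)))"

definition stretch :: "real \<Rightarrow> ('a \<Rightarrow> real) \<Rightarrow> 'a \<Rightarrow> real" where
  "stretch t f = (\<lambda>v\<in>V. (f v - (\<Sum>j<k. if v \<in> \<sigma> j then cut j t f else 0)) /
     (1 - real (Suc d) * (\<Sum>j<k. cut j t f)))"

definition height :: "('a \<Rightarrow> real) \<Rightarrow> real" where
  "height f = real (Suc d) * (\<Sum>j<k. low j f)"

section \<open>Radial stretching and the extended contraction\<close>

lemma cut_bounds:
  assumes "f \<in> topspace X" "0 \<le> t" "t \<le> 1" "j < k"
  shows "0 \<le> cut j t f" "cut j t f \<le> low j f" "real (Suc d) * cut j t f \<le> 1 / 2"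
proof -
  show "0 \<le> cut j t f" using low_nonneg[OF assms(1,4)] assms(2) by (simp add: cut_def)
  show "cut j t f \<le> low j f" by (simp add: cut_def)
  have "cut j t f \<le> t / (2 * real (Suc d))" by (simp add: cut_def)
  then have "real (Suc d) * cut j t f \<le> real (Suc d) * (t / (2 * real (Suc d)))"
    by (intro mult_left_mono) auto
  then show "real (Suc d) * cut j t f \<le> 1 / 2" using assms(3) by (simp del: of_nat_Suc)
qed

lemma stretch_Y:
  assumes "f \<in> topspace Y" "0 \<le> t" shows "stretch t f = f"
proof -
  have "cut j t f = 0" if "j < k" for j using assms that by (simp add: in_Y_iff cut_def)
  then have "(\<Sum>j<k. cut j t f) = 0" "(\<Sum>j<k. if v \<in> \<sigma> j then cut j t f else 0) = 0" for v
    by (auto intro!: sum.neutral)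
  then have "stretch t f v = f v" if "v \<in> V" for v using that by (simp add: stretch_def)
  then show ?thesis using assms(1)
    by (intro extensionalityI[of _ V]) (auto simp: topspace_realization stretch_def)
qed

text \<open>Summing over all facets makes \<open>stretch\<close> a single continuous formula; at any
  point at most one term survives.\<close>

lemma cut_sum:
  assumes f: "f \<in> topspace X" and j: "j < k" "low j f \<noteq> 0" and t: "0 \<le> t"
  shows "(\<Sum>i<k. cut i t f) = cut j t f"
    "(\<Sum>i<k. if v \<in> \<sigma> i then cut i t f else 0) = (if v \<in> \<sigma> j then cut j t f else 0)"
proof -
  have "cut i t f = 0" if "i < k" "i \<noteq> j" for i
    using low_nonzero(2)[OF f j that] t by (simp add: cut_def)
  then have "(\<Sum>i<k. cut i t f) = (\<Sum>i<k. if i = j then cut j t f else 0)"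
    "(\<Sum>i<k. if v \<in> \<sigma> i then cut i t f else 0) = (\<Sum>i<k. if i = j then (if v \<in> \<sigma> j then cut j t f else 0) else 0)"
    by (intro sum.cong; force)+
  then show "(\<Sum>i<k. cut i t f) = cut j t f"
    "(\<Sum>i<k. if v \<in> \<sigma> i then cut i t f else 0) = (if v \<in> \<sigma> j then cut j t f else 0)"
    using j(1) by simp_all
qed

text \<open>On an open facet \<open>f\<close> is the convex combination of
  \<open>stretch t f\<close> and the barycentre, the latter with weight
  \<open>real (Suc d) * cut j t f\<close>; hence the total weight stays 1. No weight turns negative
  since \<open>cut j t f \<le> low j f\<close>.\<close>

lemma stretch_X:
  assumes f: "f \<in> topspace X" and t: "0 \<le> t" "t \<le> 1" shows "stretch t f \<in> topspace X"
proof (cases "f \<in> topspace Y")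
  case True
  then show ?thesis using stretch_Y[OF True t(1)] f by simp
next
  case False
  then obtain j where j: "j < k" "low j f \<noteq> 0" using f in_Y_iff by blast
  note c = cut_bounds[OF f t j(1)]
  have s: "stretch t f v = (if v \<in> \<sigma> j then (f v - cut j t f) / (1 - real (Suc d) * cut j t f) else 0)"
    if "v \<in> V" for v
    using that low_nonzero(1)[OF f j] by (auto simp: stretch_def cut_sum[OF f j t(1)])
  have "0 \<le> stretch t f v" if "v \<in> V" for v
    unfolding s[OF that] using c low_le[OF j(1), of v f] by (auto intro!: divide_nonneg_nonneg)
  moreover have "{v \<in> V. stretch t f v \<noteq> 0} \<in> K"
    by (rule face_closedD[OF K_closed facet_in[OF j(1)]]) (auto simp: s split: if_splits)
  moreover have "(\<Sum>v\<in>V. stretch t f v) = 1"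
  proof -
    have "(\<Sum>v\<in>V. stretch t f v) = (\<Sum>v\<in>\<sigma> j. (f v - cut j t f) / (1 - real (Suc d) * cut j t f))"
      using finite_V facet_basic(3)[OF j(1)] by (intro sum.mono_neutral_cong_right) (auto simp: s)
    also have "\<dots> = ((\<Sum>v\<in>\<sigma> j. f v) - real (Suc d) * cut j t f) / (1 - real (Suc d) * cut j t f)"
      using facet_basic(4)[OF j(1)] by (simp add: sum_subtractf flip: sum_divide_distrib)
    also have "\<dots> = 1" using low_nonzero(3)[OF f j] c(3) by simp
    finally show ?thesis .
  qed
  ultimately show ?thesis by (simp add: topspace_realization) (simp add: stretch_def)
qed

lemma height_nonneg: "f \<in> topspace X \<Longrightarrow> 0 \<le> height f"
  unfolding height_def by (intro mult_nonneg_nonneg sum_nonneg) (auto simp: low_nonneg)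

text \<open>The bound on \<open>t\<close> gives \<open>cut j t f = low j f\<close>, so a vertex of
  least weight is emptied and the point lands on the boundary of its facet.\<close>

lemma stretch_into_Y:
  assumes f: "f \<in> topspace X" and t: "0 \<le> t" "t \<le> 1" and h: "2 * height f \<le> t"
  shows "stretch t f \<in> topspace Y"
proof (cases "f \<in> topspace Y")
  case True
  then show ?thesis using stretch_Y[OF True t(1)] by simp
next
  case False
  then obtain j where j: "j < k" "low j f \<noteq> 0" using f in_Y_iff by blast
  have "low j f \<le> (\<Sum>j<k. low j f)"
    using j(1) low_nonneg[OF f] by (intro member_le_sum) auto
  then have "2 * (real (Suc d) * low j f) \<le> t"
    using h unfolding height_def by (smt (verit) mult_left_mono of_nat_0_le_iff)
  then have cut: "cut j t f = low j f"
    unfolding cut_def by (intro min_absorb1) (simp add: field_simps)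
  obtain v where v: "v \<in> \<sigma> j" "f v = low j f" using low_attained[OF j(1)] .
  have "stretch t f v = 0"
    using v facet_basic(3)[OF j(1)] by (auto simp: stretch_def cut_sum[OF f j t(1)] cut)
  then have vs: "v \<notin> {w \<in> V. stretch t f w \<noteq> 0}" by simp
  have sub: "{w \<in> V. stretch t f w \<noteq> 0} \<subseteq> \<sigma> j"
    using low_nonzero(1)[OF f j] by (auto simp: stretch_def cut_sum[OF f j t(1)])
  have "{w \<in> V. stretch t f w \<noteq> 0} \<noteq> \<sigma> i" if "i < k" for i
    using facet[OF that facet_in[OF j(1)]] sub vs v(1) by blast
  then show ?thesis using stretch_X[OF f t] by (auto simp: topspace_realization)
qed

lemma wedge:
  assumes k: "0 < k" and ne: "topspace Y \<noteq> {}" and contr: "contractible_space Y"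
  shows "X homotopy_equivalent_space wedge_spheres k d"
proof -
  let ?I = "top_of_set {0..1::real}"
  obtain a c where c: "continuous_map (prod_topology ?I Y) Y c" and c0: "\<And>x. c (0, x) = x"
    and c1: "\<And>x. c (1, x) = a"
    using contr unfolding contractible_space_def homotopic_with_def by auto
  have c_in: "c (t, x) \<in> topspace Y" if "x \<in> topspace Y" "0 \<le> t" "t \<le> 1" for t x
    using continuous_map_image_subset_topspace[OF c] that by auto
  define p where "p x = 2 * height (snd x)" for x :: "real \<times> ('a \<Rightarrow> real)"
  define s where "s x = stretch (fst x) (snd x)" for x :: "real \<times> ('a \<Rightarrow> real)"
  \<comment> \<open>The clock of the contraction starts at \<open>p x\<close>, where the branches
    agree by \<open>c0\<close>. Near a barycentre \<open>p x\<close> exceeds 1 and \<open>Y\<close>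
    is not reached; this is harmless, as the value at time 1 is prescribed only on \<open>Y\<close>,
    where \<open>p x = 0\<close>.\<close>
  define h where "h x = (if p x \<le> fst x then c (fst x - p x, s x) else s x)" for x
  let ?Z = "prod_topology ?I X"
  have top: "topspace ?Z = {0..1} \<times> topspace X" by simp
  have snd: "continuous_map ?Z euclideanreal (\<lambda>x. g (snd x))" if "continuous_map X euclideanreal g" for g
    using continuous_map_compose[OF continuous_map_snd that] by (simp add: o_def)
  have fst: "continuous_map ?Z euclideanreal fst"
    using continuous_map_fst continuous_map_in_subtopology by blast
  have low: "continuous_map ?Z euclideanreal (\<lambda>x. low j (snd x))" if "j < k" for j
    by (rule snd[OF continuous_map_low[OF that]])
  have cut: "continuous_map ?Z euclideanreal (\<lambda>x. cut j (fst x) (snd x))" if "j < k" for j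
    unfolding cut_def
    by (intro continuous_map_real_min low that continuous_map_real_divide fst continuous_map_canonical_const) auto
  have pc: "continuous_map ?Z euclideanreal p"
    unfolding p_def[abs_def] height_def
    by (intro continuous_map_real_mult continuous_map_canonical_const continuous_map_sum low) auto
  have denom: "1 - real (Suc d) * (\<Sum>j<k. cut j t f) \<noteq> 0" if f: "f \<in> topspace X" and t: "0 \<le> t" "t \<le> 1" for t f
  proof (cases "f \<in> topspace Y")
    case True
    then have "cut j t f = 0" if "j < k" for j using t that by (simp add: in_Y_iff cut_def)
    then show ?thesis by simp
  next
    case False
    then obtain j where j: "j < k" "low j f \<noteq> 0" using f in_Y_iff by blast
    show ?thesis unfolding cut_sum(1)[OF f j t(1)] using cut_bounds(3)[OF f t j(1)] by simp
  qed
  have sc: "continuous_map ?Z X s"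
  proof (rule continuous_map_into_realization)
    fix v assume v: "v \<in> V"
    have if_cut: "continuous_map ?Z euclideanreal (\<lambda>x. if v \<in> \<sigma> j then cut j (fst x) (snd x) else 0)"
      if "j < k" for j using cut[OF that] by simp
    have "continuous_map ?Z euclideanreal (\<lambda>x. (snd x v - (\<Sum>j<k. if v \<in> \<sigma> j then cut j (fst x) (snd x) else 0)) /
        (1 - real (Suc d) * (\<Sum>j<k. cut j (fst x) (snd x))))"
      using denom
      by (intro continuous_map_real_divide continuous_map_diff continuous_map_sum continuous_map_real_mult
          continuous_map_canonical_const if_cut cut snd[OF continuous_map_realization_coordinate[OF v]]) auto
    then show "continuous_map ?Z euclideanreal (\<lambda>x. s x v)"
      using v by (simp add: s_def stretch_def)
  next
    fix x assume "x \<in> topspace ?Z"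
    then show "s x \<in> topspace X" using stretch_X[of "snd x" "fst x"] by (auto simp: s_def)
  qed
  have YX: "continuous_map Y X id"
    by (rule continuous_map_into_realization)
      (auto simp: continuous_map_realization_coordinate in_Y_iff)
  have hc: "continuous_map ?Z X h"
    unfolding h_def[abs_def]
  proof (rule continuous_map_cases_le[OF pc fst])
    let ?W = "subtopology ?Z {x. x \<in> topspace ?Z \<and> p x \<le> fst x}"
    have W: "0 \<le> fst x" "fst x \<le> 1" "snd x \<in> topspace X" "p x \<le> fst x" if "x \<in> topspace ?W" for x
      using that by auto
    have "continuous_map ?W ?I (\<lambda>x. fst x - p x)"
      unfolding continuous_map_in_subtopology
      using W height_nonneg
      by (intro conjI continuous_map_diff continuous_map_from_subtopology fst pc) (fastforce simp: p_def)
    moreover have "continuous_map ?W Y s"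
    proof (rule continuous_map_into_realization)
      fix v assume "v \<in> V"
      then show "continuous_map ?W euclideanreal (\<lambda>x. s x v)"
        using continuous_map_compose[OF continuous_map_from_subtopology[OF sc]
            continuous_map_realization_coordinate]
        by (simp add: o_def)
    next
      fix x assume "x \<in> topspace ?W"
      from W[OF this] show "s x \<in> topspace Y"
        unfolding s_def by (intro stretch_into_Y) (auto simp: p_def)
    qed
    ultimately have "continuous_map ?W Y (\<lambda>x. c (fst x - p x, s x))"
      using continuous_map_compose[OF continuous_map_pairedI c] by (simp add: o_def)
    from continuous_map_compose[OF this YX]
    show "continuous_map ?W X (\<lambda>x. c (fst x - p x, s x))" by (simp add: o_def)
    show "continuous_map (subtopology ?Z {x. x \<in> topspace ?Z \<and> fst x \<le> p x}) X s"
      by (rule continuous_map_from_subtopology[OF sc])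
    show "c (fst x - p x, s x) = s x" if "p x = fst x" for x
      using that c0 by simp
  qed
  have hY: "h (t, f) = c (t, f)" if f: "f \<in> topspace Y" and t: "0 \<le> t" for t f
  proof -
    have "height f = 0" using f by (simp add: in_Y_iff height_def)
    then show ?thesis using stretch_Y[OF f t] t by (simp add: h_def p_def s_def)
  qed
  show ?thesis
  proof (rule homotopy_equivalent_collapse[where h = h and a = a and A = "topspace Y" and q = chart])
    show "compact_space X" by (rule compact_space_realization[OF finite_V K_V K_closed])
    show "Hausdorff_space (wedge_spheres k d)"
      unfolding wedge_spheres_def by (intro Hausdorff_space_subtopology Hausdorff_space_powertop_real)
    show "continuous_map X (wedge_spheres k d) chart" by (rule continuous_map_chart[OF k])
    show "chart ` topspace X = topspace (wedge_spheres k d)"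
      using chart_in_wedge[OF _ k] chart_surj[OF ne] by blast
    show "f = g \<or> f \<in> topspace Y \<and> g \<in> topspace Y"
      if "f \<in> topspace X" "g \<in> topspace X" "chart f = chart g" for f g
      using chart_inj[OF that] chart_inj[OF that(2,1) that(3)[symmetric]] by metis
    show "chart f = chart g" if "f \<in> topspace Y" "g \<in> topspace Y" for f g
      using that chart_const by metis
    show "continuous_map ?Z X h" by (rule hc)
    show "h (0, f) = f" if f: "f \<in> topspace X" for f
    proof (cases "f \<in> topspace Y")
      case True
      then show ?thesis by (simp add: hY c0)
    next
      case False
      have "cut j 0 f = 0" if "j < k" for j using low_nonneg[OF f that] by (simp add: cut_def)
      then have "(\<Sum>j<k. cut j 0 f) = 0" "(\<Sum>j<k. if v \<in> \<sigma> j then cut j 0 f else 0) = 0" for v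
        by (auto intro!: sum.neutral)
      then have "stretch 0 f v = f v" if "v \<in> V" for v using that by (simp add: stretch_def)
      then have "stretch 0 f = f" using f
        by (intro extensionalityI[of _ V]) (auto simp: topspace_realization stretch_def)
      then show ?thesis using height_nonneg[OF f] by (auto simp: h_def p_def s_def c0)
    qed
    show "h (t, f) \<in> topspace Y" if "0 \<le> t" "t \<le> 1" "f \<in> topspace Y" for t f
      using hY c_in that by simp
    show "h (1, f) = a" if "f \<in> topspace Y" for f using hY[OF that] c1 by simp
  qed
qed

end

subsection \<open>Perfect matching trees give wedges of spheres\<close>

text \<open>\<open>Y\<close> may be empty: then so is \<open>X\<close>, which counts as
  contractible. Where a base point is required, nonemptiness is proved separately.\<close>

lemma contractible_space_subsingleton:
  assumes "X homotopy_equivalent_space Y" "topspace Y \<subseteq> {a}"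
  shows "contractible_space X"
proof -
  obtain f g where f: "continuous_map X Y f" and hom: "homotopic_with (\<lambda>x. True) X X (g \<circ> f) id"
    using assms(1) unfolding homotopy_equivalent_space_def by blast
  have fa: "f x = a" if "x \<in> topspace X" for x
    using continuous_map_image_subset_topspace[OF f] assms(2) that by blast
  have "homotopic_with (\<lambda>x. True) X X id (\<lambda>x. g a)"
    by (rule homotopic_with_eq[OF homotopic_with_symD[OF hom]]) (use fa in simp_all)
  then show ?thesis unfolding contractible_space_def by blast
qed

theorem matching_tree_wedge:
  fixes R :: "'a \<Rightarrow> 'a \<Rightarrow> bool"
  assumes T: "valid_mtree R (Suc d) S T" and R: "symp R" "reflp R" and k: "0 < num_crit T"
  shows "geometric_realization (set S) (flag_complex R (set S))
    homotopy_equivalent_space wedge_spheres (num_crit T) d"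
proof -
  let ?V = "set S"
  let ?G = "geometric_realization ?V"
  define K where "K = flag_complex R ?V"
  define C where "C = {I \<in> K. leaf T I = None}"
  define M where "M P = matched R P T {} ?V" for P
  have sep: "separated R {} ?V" by (simp add: separated_def flag_complex_def)
  have cell: "cell R {} ?V = K" by (simp add: cell_def K_def)
  have K: "face_closed K" "K \<subseteq> Pow ?V"
    unfolding K_def by (rule face_closed_flag_complex) (auto simp: flag_complex_def)
  have fin: "finite I" if "I \<in> K" for I using K(2) that finite_subset[of I ?V] by auto
  have M: "I \<in> M P \<longleftrightarrow> I \<in> K \<and> (\<exists>p. leaf T I = Some p \<and> P (card (insert p I)))" for I P
    by (simp add: M_def matched_def[OF R] cell)
  have cardC: "card I = Suc d" if "I \<in> C" for I
    using critical_cells(2)[OF R T sep] that by (simp add: C_def cell)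
  have "card C = num_crit T"
    using critical_cells(1)[OF R T sep] by (simp add: C_def cell)
  have dichotomy: "I \<in> C \<or> I \<in> M (\<lambda>n. d + 2 \<le> n) \<or> I \<in> M (\<lambda>n. n \<le> d + 1)" if "I \<in> K" for I
    using that by (cases "leaf T I") (auto simp: C_def M)
  \<comment> \<open>Vertex counts exceed dimensions by one, so \<open>?high\<close> selects the
    pairs whose larger member has dimension above \<open>d\<close>. The bound
    \<open>2 \<le> n\<close> spares the empty simplex and its partner, so that one vertex
    remains.\<close>
  let ?high = "M (\<lambda>n. d + 2 \<le> n)" and ?low = "M (\<lambda>n. 2 \<le> n \<and> n \<le> d + 1)"
  \<comment> \<open>A proper coface has at least \<open>d + 2\<close> vertices, too many to be
    critical, so it belongs to a high pair as well.\<close>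
  have high_up: "J \<in> ?high" if IJ: "I \<in> ?high" "J \<in> K" "I \<subseteq> J" for I J
  proof (cases "I = J")
    case False
    obtain p where "I \<in> K" and "d + 2 \<le> card (insert p I)"
      using IJ(1) unfolding M by blast
    then have "d + 1 \<le> card I"
      using fin[of I] by (simp add: card_insert_if split: if_splits)
    then have J: "d + 2 \<le> card J"
      using psubset_card_mono[OF fin[OF IJ(2)] psubsetI[OF IJ(3) False]] by simp
    have "leaf T J \<noteq> None" using cardC[of J] J IJ(2) by (auto simp: C_def)
    then obtain p where "leaf T J = Some p" by blast
    moreover have "d + 2 \<le> card (insert p J)"
      using J fin[OF IJ(2)] by (simp add: card_insert_if)
    ultimately show ?thesis using IJ(2) unfolding M by blast
  qed (use IJ in simp)
  let ?K1 = "K - ?high"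
  have K1: "face_closed ?K1" "?K1 \<subseteq> Pow ?V"
    using K high_up unfolding face_closed_def by blast+
  have C_K1: "C \<subseteq> ?K1" by (auto simp: C_def M)
  \<comment> \<open>The noncritical simplices left have at most \<open>d + 1\<close> vertices, so
    none properly contains a critical one.\<close>
  have C_max: "I = c" if "c \<in> C" "I \<in> ?K1" "c \<subseteq> I" for c I
  proof (rule ccontr)
    assume "I \<noteq> c"
    then have card: "d + 2 \<le> card I"
      using psubset_card_mono[OF fin psubsetI[OF that(3)]] that(2) cardC[OF that(1)] by auto
    then have "I \<notin> C" using cardC by auto
    with that(2) dichotomy[of I] obtain p where "card (insert p I) \<le> d + 1" by (auto simp: M)
    moreover have "card I \<le> card (insert p I)" using fin[of I] that(2) by (intro card_mono) auto
    ultimately show False using card by simp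
  qed
  let ?D = "?K1 - C"
  have D: "face_closed ?D" "?D \<subseteq> Pow ?V"
    using K1 C_max unfolding face_closed_def by blast+
  have high: "?G K homotopy_equivalent_space ?G ?K1"
  proof -
    have "?high \<subseteq> K" by (simp add: subset_iff M)
    then show ?thesis
      using matched_collapse[OF R T sep finite_set K(2,1), folded M_def, OF _ high_up] by simp
  qed
  have low: "?G ?D homotopy_equivalent_space ?G (?D - ?low)"
  proof -
    have sub: "?low \<subseteq> ?D"
    proof
      fix I assume "I \<in> ?low"
      then obtain p where "I \<in> K" "leaf T I = Some p" "card (insert p I) \<le> d + 1"
        unfolding M by blast
      then show "I \<in> ?D" by (simp add: M C_def)
    qed
    \<comment> \<open>In \<open>?D\<close> every simplex is in a pair of size at most
      \<open>d + 1\<close>, so only the lower bound is at stake; a proper coface of a nonempty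
      simplex has two vertices.\<close>
    have up: "J \<in> ?low" if IJ: "I \<in> ?low" "J \<in> ?D" "I \<subseteq> J" for I J
    proof (cases "I = J")
      case False
      obtain p where p: "I \<in> K" "leaf T I = Some p" "2 \<le> card (insert p I)"
        using IJ(1) unfolding M by blast
      have "J \<in> K" and JM: "J \<in> M (\<lambda>n. n \<le> d + 1)" using IJ(2) dichotomy[of J] by auto
      from JM obtain q where q: "leaf T J = Some q" "card (insert q J) \<le> d + 1"
        unfolding M by blast
      have "1 \<le> card I" using p(3) fin[OF p(1)] by (simp add: card_insert_if split: if_splits)
      then have "2 \<le> card J"
        using psubset_card_mono[OF fin[OF \<open>J \<in> K\<close>] psubsetI[OF IJ(3) False]] by simp
      moreover have "card J \<le> card (insert q J)" using fin[OF \<open>J \<in> K\<close>] by (intro card_mono) auto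
      ultimately have "2 \<le> card (insert q J)" by simp
      then show ?thesis using q \<open>J \<in> K\<close> unfolding M by blast
    qed (use IJ in simp)
    show ?thesis
      using matched_collapse[OF R T sep finite_set D(2,1), folded M_def, OF sub up] by simp
  qed
  have "{} \<in> K" by (simp add: K_def flag_complex_def)
  moreover have "leaf T {} \<noteq> None" using cardC[of "{}"] calculation by (auto simp: C_def)
  ultimately obtain p where p: "leaf T {} = Some p" by auto
  note p_toggle = leaf_toggle[OF R T sep, unfolded cell, OF \<open>{} \<in> K\<close> p]
  \<comment> \<open>A survivor lies in a pair of size 1, so toggling its vertex \<open>q\<close>
    leads to the empty simplex, whose toggle vertex is \<open>p\<close>; hence
    \<open>q = p\<close>.\<close>
  have "I \<subseteq> {p}" if I: "I \<in> ?D - ?low" for I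
  proof -
    have IK: "I \<in> K" "I \<in> M (\<lambda>n. n \<le> d + 1)" using I dichotomy by auto
    then obtain q where q: "leaf T I = Some q" "card (insert q I) \<le> 1" using I by (auto simp: M)
    have "0 < card (insert q I)" using fin[OF IK(1)] by (simp add: card_gt_0_iff)
    with q(2) have "card (insert q I) = 1" by linarith
    then have sub: "I \<subseteq> {q}" by (metis card_1_singletonE insert_iff singletonD subsetI)
    then have "I - {q} = {}" by blast
    moreover have "leaf T (I - {q}) = Some q"
      using leaf_toggle[OF R T sep, unfolded cell, OF IK(1) q(1)] by blast
    ultimately have "leaf T {} = Some q" by metis
    then show ?thesis using sub p by simp
  qed
  then have "topspace (?G (?D - ?low)) \<subseteq> {\<lambda>v\<in>?V. if v = p then 1 else 0}"
    (is "_ \<subseteq> {?f}")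
  proof (intro subsetI)
    fix f assume f: "f \<in> topspace (?G (?D - ?low))"
    assume *: "\<And>I. I \<in> ?D - ?low \<Longrightarrow> I \<subseteq> {p}"
    have supp: "{v \<in> ?V. f v \<noteq> 0} \<subseteq> {p}"
      by (rule *) (use f in \<open>simp add: topspace_realization\<close>)
    have pV: "p \<in> ?V" using p_toggle by blast
    have "(\<Sum>v\<in>?V. f v) = (\<Sum>v\<in>{p}. f v)"
      using supp pV by (intro sum.mono_neutral_right) auto
    then have "f p = 1" using f by (simp add: topspace_realization)
    then have "f v = ?f v" if "v \<in> ?V" for v using that supp by auto
    then show "f \<in> {?f}" using f
      by (simp add: topspace_realization) (intro extensionalityI[of _ ?V]; auto)
  qed
  with low have contr: "contractible_space (?G ?D)" by (rule contractible_space_subsingleton)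
  have "{p} \<in> ?D"
    using p_toggle by (auto simp: M C_def)
  moreover have "p \<in> ?V" using p_toggle by blast
  ultimately have ne: "topspace (?G ?D) \<noteq> {}"
  proof -
    assume "{p} \<in> ?D" "p \<in> ?V"
    moreover have "{v \<in> ?V. (\<lambda>v\<in>?V. if v = p then 1 else (0::real)) v \<noteq> 0} = {p}"
      using \<open>p \<in> ?V\<close> by auto
    ultimately have "(\<lambda>v\<in>?V. if v = p then 1 else 0) \<in> topspace (?G ?D)"
      by (simp add: topspace_realization)
    then show ?thesis by blast
  qed
  have finC: "finite C" using K(2) by (auto simp: C_def intro: finite_subset[of _ "Pow ?V"])
  then obtain \<sigma> where \<sigma>: "bij_betw \<sigma> {..<num_crit T} C"
    using ex_bij_betw_nat_finite[OF finC] \<open>card C = num_crit T\<close> by (auto simp: atLeast0LessThan)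
  have "\<exists>e. bij_betw e {..d} (\<sigma> j)" if "j < num_crit T" for j
  proof -
    have "\<sigma> j \<in> C" using \<sigma> that by (auto simp: bij_betw_def)
    then have "card (\<sigma> j) = card {..d}" "finite (\<sigma> j)"
      using cardC fin by (auto simp: C_def)
    then show ?thesis using bij_betw_iff_card[of "{..d}" "\<sigma> j"] by simp
  qed
  then obtain e where e: "\<And>j. j < num_crit T \<Longrightarrow> bij_betw (e j) {..d} (\<sigma> j)" by metis
  have \<sigma>C: "\<sigma> j \<in> C" if "j < num_crit T" for j using \<sigma> that by (auto simp: bij_betw_def)
  interpret facets ?V ?K1 \<sigma> e "num_crit T" d
  proof
    show "inj_on \<sigma> {..<num_crit T}" using \<sigma> by (simp add: bij_betw_def)
    show "I = \<sigma> j" if "j < num_crit T" "I \<in> ?K1" "\<sigma> j \<subseteq> I" for j I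
      using C_max \<sigma>C that by blast
    show "\<sigma> j \<in> ?K1" if "j < num_crit T" for j using \<sigma>C[OF that] C_K1 by blast
  qed (fact K1 e finite_set)+
  have "\<sigma> ` {..<num_crit T} = C" using \<sigma> by (simp add: bij_betw_def)
  with wedge[OF k] ne contr
  have "?G ?K1 homotopy_equivalent_space wedge_spheres (num_crit T) d" by simp
  with high show ?thesis unfolding K_def by (rule homotopy_eqv_trans)
qed

section \<open>Vietoris-Rips complexes of torus grids\<close>

lemma geometric_realization_VR:
  assumes V: "finite V"
  shows "geometric_realization V (VR_simplices V d r) =
    geometric_realization V (flag_complex (\<lambda>x y. d x y \<le> r) V)"
proof -
  have "{v \<in> V. f v \<noteq> 0} \<in> VR_simplices V d r \<longleftrightarrow> {v \<in> V. f v \<noteq> 0} \<in> flag_complex (\<lambda>x y. d x y \<le> r) V"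
    if "sum f V = 1" for f :: "'a \<Rightarrow> real"
  proof -
    \<comment> \<open>The two families differ only in the empty set, which is never the support of a
      point of total weight 1.\<close>
    have "{v \<in> V. f v \<noteq> 0} \<noteq> {}"
      using that by (metis (mono_tags, lifting) empty_Collect_eq sum.neutral zero_neq_one)
    then show ?thesis using V by (simp add: VR_simplices_def flag_complex_def)
  qed
  then show ?thesis
    unfolding geometric_realization_def by (intro arg_cong2[where f = subtopology] refl) blast
qed

lemma cyc_dist_commute: "cyc_dist n a b = cyc_dist n b a"
  by (auto simp: cyc_dist_def Let_def)

lemma torus_dist_le_symp: "symp (\<lambda>p q. torus_dist n p q \<le> r)"
  by (simp add: symp_def torus_dist_def cyc_dist_commute)

lemma torus_dist_le_reflp: "reflp (\<lambda>p q. torus_dist n p q \<le> r)"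
  by (simp add: reflp_def torus_dist_def cyc_dist_def)

lemma torus_VR_wedge:
  assumes "valid_mtree (\<lambda>p q. torus_dist n p q \<le> r) (Suc d) (List.product [0..<n] [0..<n]) T"
    and "0 < num_crit T"
  shows "geometric_realization (torus_grid n) (VR_simplices (torus_grid n) (torus_dist n) r)
    homotopy_equivalent_space wedge_spheres (num_crit T) d"
proof -
  have "torus_grid n = set (List.product [0..<n] [0..<n])"
    by (simp add: torus_grid_def)
  then show ?thesis
    using matching_tree_wedge[OF assms(1) torus_dist_le_symp torus_dist_le_reflp assms(2)]
      geometric_realization_VR[of "torus_grid n" "torus_dist n" r]
    by simp
qed

text \<open>Translation by \<open>e_0\<close> moves the centre to the origin; blocks other than 0
  carry only zeros.\<close>

lemma wedge_spheres_one: "wedge_spheres 1 n homeomorphic_space nsphere n"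
proof -
  define \<phi> where "\<phi> x = (\<lambda>i. x (0, i) - (if i = 0 then 1 else 0))" for x :: "nat \<times> nat \<Rightarrow> real"
  define \<psi> :: "(nat \<Rightarrow> real) \<Rightarrow> nat \<times> nat \<Rightarrow> real" where
    "\<psi> y = (\<lambda>(a, i). if a = 0 then y i + (if i = 0 then 1 else 0) else 0)" for y
  have W: "wedge_spheres 1 n = subtopology (powertop_real UNIV)
      {x. (\<forall>a i. a \<noteq> 0 \<or> i > n \<longrightarrow> x (a, i) = 0) \<and> (\<Sum>i\<le>n. (\<phi> x i)\<^sup>2) = 1}"
    unfolding wedge_spheres_def \<phi>_def by (simp only: less_one simp_thms)
  have "continuous_map (wedge_spheres 1 n) (nsphere n) \<phi>"
    unfolding nsphere continuous_map_in_subtopology continuous_map_componentwise_UNIV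
  proof (intro conjI allI)
    show "continuous_map (wedge_spheres 1 n) euclideanreal (\<lambda>x. \<phi> x i)" for i
      unfolding \<phi>_def W
      by (intro continuous_map_diff continuous_map_from_subtopology continuous_map_product_projection) auto
  qed (auto simp: W[simplified] \<phi>_def)
  moreover have "continuous_map (nsphere n) (wedge_spheres 1 n) \<psi>"
    unfolding W continuous_map_in_subtopology continuous_map_componentwise_UNIV
  proof (intro conjI allI)
    show "continuous_map (nsphere n) euclideanreal (\<lambda>y. \<psi> y p)" for p
      by (cases p) (auto simp: \<psi>_def intro!: continuous_map_add continuous_map_nsphere_projection)
  qed (auto simp: nsphere \<psi>_def \<phi>_def)
  moreover have "\<psi> (\<phi> x) = x" if "x \<in> topspace (wedge_spheres 1 n)" for x
    using that by (auto simp: W[simplified] \<psi>_def \<phi>_def fun_eq_iff)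
  moreover have "\<phi> (\<psi> y) = y" for y
    by (simp add: \<psi>_def \<phi>_def)
  ultimately show ?thesis
    unfolding homeomorphic_space_def homeomorphic_maps_def by blast
qed

subsection \<open>The torus grids\<close>

text \<open>At scale 3 a vertex is incompatible with only four others, those at cyclic distance 2 in
  both coordinates; \<open>Free p\<close> is valid once these four are no longer undecided while
  \<open>p\<close> still is. The empty simplex is paired with \<open>(3,3)\<close>.\<close>

definition tree5 :: "(nat \<times> nat) mtree" where "tree5 =
Split (0,1)
 (Split (0,4) (Free (0,0))
 (Split (0,3) (Free (0,2))
 (Split (2,1) (Free (1,1))
 (Split (4,1) (Free (3,1))
 (Split (1,1)
 (Split (1,4) (Free (1,0))
 (Split (1,3) (Free (1,2))
 (Free (3,1))))
 (Split (4,2) (Free (4,3))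
 (Split (4,0) (Free (4,4))
 (Split (0,2)
 (Split (2,2) (Free (1,2))
 (Split (1,0) (Free (0,0))
 (Free (4,3))))
 (Split (1,0) (Free (2,0))
 (Split (2,0) (Split (3,1)
 (Split (4,4) (Free (3,0))
 (Split (3,2) (Free (2,2))
 (Split (0,0) (Split (1,2) (Crit) (Free (3,0))) (Free (2,2)))))
 (Split (1,2) (Free (1,3))
 (Split (0,0) (Free (1,4))
 (Split (1,3) (Split (1,4) (Split (2,2) (Crit) (Free (4,4))) (Free (3,2))) (Free (3,0)))))) (Free (4,3))))))))))))
 (Split (3,2)
 (Split (1,2) (Free (2,2))
 (Split (1,3) (Free (2,3))
 (Split (2,0) (Free (3,0))
 (Split (2,1) (Free (3,1))
 (Split (3,0) (Free (3,1))
 (Split (3,4) (Free (3,3))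
 (Split (4,1) (Free (0,2))
 (Split (4,2) (Free (0,2))
 (Split (2,2) (Free (2,3))
 (Split (4,3) (Free (3,3))
 (Split (4,4) (Free (3,3))
 (Split (0,2) (Split (0,3) (Split (1,1) (Split (2,3) (Crit) (Free (4,0))) (Free (3,3))) (Free (3,1))) (Free (2,4))))))))))))))
 (Split (1,1)
 (Split (4,0) (Free (0,0))
 (Split (1,4) (Free (1,0))
 (Split (2,0) (Free (1,0))
 (Split (2,4) (Free (1,0))
 (Split (0,3) (Free (0,2))
 (Split (1,2) (Free (0,2))
 (Split (1,3) (Free (0,2))
 (Split (2,2) (Free (2,1))
 (Split (4,1) (Free (0,0))
 (Split (3,1) (Free (2,1))
 (Split (0,0) (Split (0,2) (Split (0,4) (Split (1,0) (Crit) (Free (4,2))) (Free (2,1))) (Free (3,0))) (Free (2,3)))))))))))))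
 (Split (3,0) (Free (3,4))
 (Split (4,2)
 (Split (1,2) (Free (0,2))
 (Split (0,4) (Free (0,3))
 (Split (2,2) (Free (3,3))
 (Split (2,3) (Free (3,3))
 (Split (3,1) (Free (4,0))
 (Split (4,3) (Free (0,3))
 (Split (4,4) (Free (0,3))
 (Split (4,1) (Free (4,0))
 (Split (0,0) (Split (0,2) (Split (0,3) (Split (1,3) (Crit) (Free (4,0))) (Free (2,1))) (Free (3,4))) (Free (3,3)))))))))))
 (Split (1,3) (Free (1,4))
 (Split (4,3)
 (Split (0,4) (Free (0,3))
 (Split (1,4) (Free (0,3))
 (Split (2,2) (Free (3,3))
 (Split (2,3) (Free (3,3))
 (Split (3,4) (Free (4,0))
 (Split (4,1) (Free (0,2))
 (Split (4,4) (Free (4,0))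
 (Split (0,0) (Split (0,2) (Split (0,3) (Split (1,2) (Crit) (Free (4,0))) (Free (3,1))) (Free (2,4))) (Free (3,3))))))))))
 (Split (0,0) (Free (1,0))
 (Split (1,0) (Split (4,0)
 (Split (0,3) (Free (0,4))
 (Split (2,4) (Free (2,0))
 (Split (3,4) (Free (2,0))
 (Split (3,1) (Free (4,1))
 (Split (4,4) (Free (0,4))
 (Split (0,2) (Split (0,4) (Split (1,4) (Crit) (Free (4,1))) (Free (2,1))) (Free (2,0))))))))
 (Split (2,1) (Free (2,2))
 (Split (1,4) (Free (2,3))
 (Split (2,4) (Free (2,3))
 (Split (2,3) (Split (0,3)
 (Split (1,2) (Free (0,2))
 (Split (4,4) (Free (0,4))
 (Split (0,2) (Split (0,4) (Crit) (Free (2,2))) (Free (3,4)))))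
 (Split (3,4) (Free (2,0))
 (Split (2,2) (Free (1,2))
 (Split (0,2) (Split (0,4) (Split (1,2) (Crit) (Free (4,4))) (Free (3,1))) (Free (2,0)))))) (Free (4,1))))))) (Free (3,3))))))))))"

text \<open>At scale 4 a vertex is incompatible with twelve others, those at cyclic distances (2,3),
  (3,2) or (3,3). The \<open>Crit\<close> leaf is the simplex with vertices \<open>(0,1)\<close>,
  \<open>(0,4)\<close>, \<open>(1,5)\<close>, \<open>(2,3)\<close>; the empty simplex is paired with
  \<open>(3,4)\<close>.\<close>

definition tree7 :: "(nat \<times> nat) mtree" where "tree7 =
Split (4,0)
 (Split (2,0) (Free (3,0))
 (Split (2,2) (Free (3,1))
 (Split (2,5) (Free (3,6))
 (Split (3,2) (Free (4,1))
 (Split (3,3) (Free (4,1))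
 (Split (4,2) (Free (4,1))
 (Split (1,1) (Free (0,0))
 (Split (3,4) (Free (4,6))
 (Free (5,0))))))))))
 (Split (6,4)
 (Split (1,2) (Free (0,3))
 (Split (1,4) (Free (0,4))
 (Split (1,6) (Free (0,5))
 (Split (3,4) (Free (4,4))
 (Split (4,2) (Free (5,3))
 (Split (1,3) (Free (0,4))
 (Split (2,3) (Free (0,4))
 (Split (3,5) (Free (4,5))
 (Split (2,4) (Free (5,4))
 (Split (3,3) (Free (5,4))
 (Free (6,5))))))))))))
 (Split (4,4)
 (Split (2,2) (Free (3,3))
 (Split (2,4) (Free (3,4))
 (Split (2,6) (Free (3,5))
 (Split (3,1) (Free (4,3))
 (Split (3,2) (Free (4,3))
 (Split (4,2) (Free (4,3))
 (Split (1,3) (Free (0,4))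
 (Split (3,0) (Free (4,5))
 (Free (5,4))))))))))
 (Split (3,6)
 (Split (1,1) (Free (2,0))
 (Split (2,2) (Free (2,1))
 (Split (1,4) (Free (2,5))
 (Split (1,6) (Free (2,6))
 (Split (2,1) (Free (3,0))
 (Split (3,1) (Free (3,0))
 (Split (2,3) (Free (3,5))
 (Free (4,6)))))))))
 (Split (3,5)
 (Split (2,2) (Free (2,3))
 (Split (1,3) (Free (2,4))
 (Split (1,5) (Free (2,5))
 (Split (1,0) (Free (2,6))
 (Split (1,6) (Free (2,6))
 (Split (2,3) (Free (3,4))
 (Split (3,3) (Free (3,4))
 (Split (0,4) (Free (4,5))
 (Split (0,5) (Free (4,5))
 (Split (5,3) (Free (4,5))
 (Split (1,4) (Free (2,5))
 (Free (4,6)))))))))))))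
 (Split (2,2) (Free (1,2))
 (Split (2,4)
 (Split (1,1) (Free (1,2))
 (Split (0,2) (Free (1,3))
 (Split (0,4) (Free (1,4))
 (Split (0,6) (Free (1,5))
 (Split (1,2) (Free (2,3))
 (Split (1,0) (Free (2,5))
 (Free (3,4))))))))
 (Split (2,0)
 (Split (0,0) (Free (1,0))
 (Split (0,2) (Free (1,1))
 (Split (1,3) (Free (1,2))
 (Split (0,5) (Free (1,6))
 (Split (1,2) (Free (2,1))
 (Split (1,4) (Free (2,6))
 (Free (3,0))))))))
 (Split (4,2) (Free (5,2))
 (Split (4,3)
 (Split (2,1) (Free (3,2))
 (Split (2,3) (Free (3,3))
 (Split (2,5) (Free (3,4))
 (Split (3,0) (Free (4,1))
 (Free (5,3))))))
 (Split (3,2)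
 (Split (6,2) (Free (0,2))
 (Split (1,0) (Free (2,1))
 (Split (1,4) (Free (2,3))
 (Split (2,6) (Free (3,1))
 (Split (3,0) (Free (3,1))
 (Split (0,1) (Free (0,2))
 (Split (2,3) (Free (3,3))
 (Split (2,5) (Free (3,3))
 (Free (5,2))))))))))
 (Split (5,0) (Free (6,0))
 (Split (4,6)
 (Split (1,0) (Free (0,0))
 (Split (2,1) (Free (3,0))
 (Split (3,3) (Free (4,5))
 (Free (5,6)))))
 (Split (0,5) (Free (0,4))
 (Split (2,1) (Free (1,2))
 (Split (1,4) (Free (0,4))
 (Split (5,3) (Free (5,2))
 (Split (3,1)
 (Split (6,1) (Free (0,0))
 (Split (0,2) (Free (1,1))
 (Split (1,1) (Free (1,2))
 (Split (1,3) (Free (1,2))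
 (Split (1,6) (Free (2,6))
 (Split (2,5) (Free (2,6))
 (Free (4,1))))))))
 (Split (1,3) (Free (0,4))
 (Split (2,5) (Free (1,5))
 (Split (1,0) (Free (0,1))
 (Split (0,0) (Free (6,0))
 (Split (0,6) (Free (6,0))
 (Split (5,1) (Free (5,2))
 (Split (0,3) (Free (0,4))
 (Split (6,5) (Free (0,4))
 (Split (6,2) (Free (5,2))
 (Split (6,1) (Free (6,0))
 (Split (1,6) (Free (1,5))
 (Split (5,5) (Free (4,5))
 (Split (3,3) (Free (2,3))
 (Split (1,1) (Free (0,1))
 (Split (6,6) (Free (6,0))
 (Split (0,2) (Free (6,3))
 (Split (5,4) (Free (4,5))
 (Split (6,0)
 (Split (1,2) (Free (0,1))
 (Free (5,6)))
 (Split (1,2) (Free (2,3))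
 (Split (4,5) (Free (3,4))
 (Split (0,1) (Split (2,3) (Split (4,1)
 (Split (2,6) (Free (3,0))
 (Free (5,2)))
 (Split (6,3) (Free (0,4))
 (Split (2,6) (Free (1,5))
 (Split (0,4) (Split (1,5) (Crit) (Free (5,2))) (Free (3,0)))))) (Free (5,6))) (Free (3,4))))))))))))))))))))))))))))))))))))))))"

text \<open>The argument 5 after the relation, like 4 for \<open>tree7\<close>, counts the vertices
  of a critical simplex, one more than the dimension of the sphere.\<close>

lemma valid_tree5:
  "valid_mtree (\<lambda>p q. torus_dist 5 p q \<le> 3) 5 (List.product [0..<5] [0..<5]) tree5"
  by code_simp

lemma valid_tree7:
  "valid_mtree (\<lambda>p q. torus_dist 7 p q \<le> 4) 4 (List.product [0..<7] [0..<7]) tree7"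
  by code_simp

lemma num_crit_trees: "num_crit tree5 = 9" "num_crit tree7 = 1"
  by code_simp+

theorem theorem7p1:
  shows "geometric_realization (torus_grid 5) (VR_simplices (torus_grid 5) (torus_dist 5) 3)
           homotopy_equivalent_space wedge_spheres 9 4
       \<and> geometric_realization (torus_grid 7) (VR_simplices (torus_grid 7) (torus_dist 7) 4)
           homotopy_equivalent_space nsphere 3"
proof
  show "geometric_realization (torus_grid 5) (VR_simplices (torus_grid 5) (torus_dist 5) 3)
      homotopy_equivalent_space wedge_spheres 9 4"
    using torus_VR_wedge[of 5 3 4 tree5] valid_tree5 num_crit_trees by simp
  have "geometric_realization (torus_grid 7) (VR_simplices (torus_grid 7) (torus_dist 7) 4)
      homotopy_equivalent_space wedge_spheres 1 3"
    using torus_VR_wedge[of 7 4 3 tree7] valid_tree7 num_crit_trees by simp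
  also have "wedge_spheres 1 3 homotopy_equivalent_space nsphere 3"
    by (intro homeomorphic_imp_homotopy_equivalent_space wedge_spheres_one)
  finally show "geometric_realization (torus_grid 7) (VR_simplices (torus_grid 7) (torus_dist 7) 4)
      homotopy_equivalent_space nsphere 3" .
qed

end
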